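(* Let $n\ge 1$ and $\rho>1$, and let $E_\rho\subset\mathbb C$ be the open Bernstein ellipse (foci $\pm1$, semi-major plus semi-minor axis equal to $\rho$) with closure $\bar E_\rho$ and boundary $\partial E_\rho$. Let $A:\bar E_\rho\to\mathbb C^{n\times n}$ and $\boldsymbol b:\bar E_\rho\to\mathbb C^n$ be continuous on $\bar E_\rho$ and analytic on $E_\rho$, with $A(t)$ invertible for every $t\in\bar E_\rho$. Put $\boldsymbol x(t)=A(t)^{-1}\boldsymbol b(t)$ and $\kappa_\rho:=\max_{t\in\partial E_\rho}\|\boldsymbol x(t)\|_2$. Let $M\ge2$, $\Delta t=2/(M-1)$, and let $\tau_k=-1+(k-1)\Delta t$ for $k=1,\dots,M$ (equispaced points on $[-1,1]$). Let $R$ be a nonnegative integer with $R\le\frac12\sqrt{M-1}$, let $\mathbb P_R$ be the set of vector-valued polynomials $\boldsymbol p(t)=\boldsymbol v_0+\boldsymbol v_1t+\cdots+\boldsymbol v_Rt^R$ with $\boldsymbol v_j\in\mathbb C^n$, and let $$\boldsymbol p_R=\operatorname{argmin}_{\boldsymbol p\in\mathbb P_R}\big\|[\boldsymbol x(\tau_1)|\cdots|\boldsymbol x(\tau_M)]-[\boldsymbol p(\tau_1)|\cdots|\boldsymbol p(\tau_M)]\big\|_F.$$ Then for every $t\in\big(1,(\rho+\rho^{-1})/2\big)$, with $r=(t+\sqrt{t^2-1})/\rho<1$, $$\|\boldsymbol x(t)-\boldsymbol p_R(t)\|_2\le 2\kappa_\rho\Big[\frac{1}{1-r}+\frac{C(M,R)\,\rho}{(\rho-1)\sqrt{\rho^2r^2-1}}\Big]r^{R+1},$$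 where $C(M,R)=5\sqrt5\,\sqrt{2R+1}\,\sqrt M/\sqrt{2(M-1)}$.
   Context: $\|\cdot\|_2$ is the Euclidean norm, $\|\cdot\|_F$ the Frobenius norm. For $t>1$, $\boldsymbol x(t)$ denotes the value of the analytic extension (the point $t$ lies in $E_\rho$ for $t<(\rho+\rho^{-1})/2$). The least-squares minimizer $\boldsymbol p_R$ is unique since $R\le M-1$. *)

theory Defs
  imports "HOL-Analysis.Analysis"
begin

text \<open>Open Bernstein ellipse: foci +-1, semi-axes (rho + 1/rho)/2 and (rho - 1/rho)/2,
  so that semi-major plus semi-minor axis equals rho.\<close>
definition bernstein_ellipse :: "real \<Rightarrow> complex set" where
  "bernstein_ellipse \<rho> =
     {z. (Re z / ((\<rho> + 1/\<rho>) / 2))\<^sup>2 + (Im z / ((\<rho> - 1/\<rho>) / 2))\<^sup>2 < 1}"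

definition vpoly :: "nat \<Rightarrow> (nat \<Rightarrow> complex ^ 'n) \<Rightarrow> complex \<Rightarrow> complex ^ 'n" where
  "vpoly R v t = (\<Sum>j\<le>R. (t ^ j) *s v j)"

definition equi_node :: "nat \<Rightarrow> nat \<Rightarrow> real" where
  "equi_node M k = -1 + (real k - 1) * (2 / (real M - 1))"

text \<open>Frobenius norm of [x(tau_1)|...|x(tau_M)] - [p(tau_1)|...|p(tau_M)].\<close>
definition frob_residual :: "nat \<Rightarrow> (complex \<Rightarrow> complex ^ 'n) \<Rightarrow> (complex \<Rightarrow> complex ^ 'n) \<Rightarrow> real" where
  "frob_residual M x p =
     sqrt (\<Sum>k=1..M. (norm (x (complex_of_real (equi_node M k)) - p (complex_of_real (equi_node M k))))\<^sup>2)"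

end

theory Submission
  imports Defs "HOL-Computational_Algebra.Polynomial" "HOL-Complex_Analysis.Cauchy_Integral_Formula"
begin

text \<open>Let \<open>q\<close> be the truncation of the Chebyshev series of \<open>x\<close> after degree \<open>R\<close>. Under \<open>z = (u + 1/u) / 2\<close> the
  circle of radius \<open>\<rho>\<close> becomes the boundary of the ellipse, and Cauchy's kernel becomes the generating function
  \<open>1 + 2 \<Sum> T\<^sub>k(z) \<zeta>\<^sup>-\<^sup>k\<close>; its geometric tail gives \<open>norm (x - q) \<le> 2 \<kappa> r^(R+1) / (1 - r)\<close> at
  \<open>t\<close>, and the same with \<open>1/\<rho>\<close> in place of \<open>r\<close> on \<open>[-1, 1]\<close>. By minimality, the discrete norm of
  \<open>e = q - p\<^sub>R\<close> is at most that of \<open>x - q\<close>. Since \<open>4 R\<^sup>2 \<le> M - 1\<close>, the trapezoidal rule together with an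
  \<open>L\<^sup>2\<close> Markov inequality bounds the \<open>L\<^sup>2\<close> norm of \<open>e\<close> on \<open>[-1, 1]\<close> by its discrete norm, and the Legendre
  expansion with \<open>P\<^sub>k(t) \<le> (t + sqrt (t\<^sup>2 - 1))^k\<close> bounds \<open>e(t)\<close> by the \<open>L\<^sup>2\<close> norm.\<close>

section \<open>Legendre polynomials\<close>

text \<open>Bonnet's recurrence, normalised to the value \<open>1\<close> at the point
  \<open>1\<close>, serves as the definition, so that endpoint values, derivative identities and
  growth bounds all come by induction.\<close>

fun legendre :: "nat \<Rightarrow> real poly" where
  "legendre 0 = 1"
| "legendre (Suc 0) = [:0, 1:]"
| "legendre (Suc (Suc n)) =
     smult (1 / (real n + 2))
       (smult (2 * real n + 3) ([:0, 1:] * legendre (Suc n)) - smult (real n + 1) (legendre n))"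

lemma legendre_bonnet:
  "(real n + 2) * poly (legendre (Suc (Suc n))) x =
     (2 * real n + 3) * x * poly (legendre (Suc n)) x - (real n + 1) * poly (legendre n) x"
  by (simp add: field_simps)

lemma degree_legendre_le: "degree (legendre n) \<le> n"
proof (induction n rule: legendre.induct)
  case (3 n)
  have "degree ([:0, 1:] * legendre (Suc n)) \<le> Suc (Suc n)"
    using degree_mult_le[of "[:0, 1:]" "legendre (Suc n)"] 3(1) by simp
  then show ?case
    using 3(2) by (auto intro!: degree_diff_le order.trans[OF degree_smult_le])
qed auto

lemma coeff_legendre_pos: "coeff (legendre n) n > 0"
proof (induction n rule: legendre.induct)
  case (3 n)
  have "coeff (legendre n) (Suc (Suc n)) = 0"
    using degree_legendre_le[of n] by (intro coeff_eq_0) simp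
  then show ?case
    using 3 by simp
qed auto

lemma poly_legendre_1: "poly (legendre n) 1 = 1"
  by (induction n rule: legendre.induct) (simp_all add: field_simps)

lemma poly_legendre_minus_1: "poly (legendre n) (-1) = (-1) ^ n"
  by (induction n rule: legendre.induct) (simp_all add: field_simps)

text \<open>The two identities carry each other through one induction. Differentiating Bonnet's
  recurrence and eliminating \<open>?D n\<close> by the second identity gives the first one index
  higher; this, Bonnet's recurrence and both hypotheses give the second.\<close>

lemma poly_pderiv_legendre:
  "poly (pderiv (legendre (Suc n))) x =
     x * poly (pderiv (legendre n)) x + (real n + 1) * poly (legendre n) x"
  "x * poly (pderiv (legendre (Suc n))) x - poly (pderiv (legendre n)) x =
     (real n + 1) * poly (legendre (Suc n)) x"
proof (induction n)
  case 0
  {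
    case 1 then show ?case by (simp add: pderiv_pCons)
  next
    case 2 then show ?case by (simp add: pderiv_pCons)
  }
next
  case (Suc n)
  let ?P = "\<lambda>n. poly (legendre n) x" and ?D = "\<lambda>n. poly (pderiv (legendre n)) x"
  have B: "(real n + 2) * ?P (Suc (Suc n)) = (2 * real n + 3) * x * ?P (Suc n) - (real n + 1) * ?P n"
    by (rule legendre_bonnet)
  have D: "(real n + 2) * ?D (Suc (Suc n)) =
      (2 * real n + 3) * (?P (Suc n) + x * ?D (Suc n)) - (real n + 1) * ?D n"
    by (simp add: pderiv_smult pderiv_diff pderiv_mult pderiv_pCons del: mult_pCons_left)
  have "(real n + 2) * ?D (Suc (Suc n)) = (real n + 2) * (x * ?D (Suc n) + (real n + 2) * ?P (Suc n))"
    using D Suc(2) by algebra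
  then have a: "?D (Suc (Suc n)) = x * ?D (Suc n) + (real n + 2) * ?P (Suc n)"
    by (simp del: legendre.simps)
  {
    case 1 then show ?case using a by (simp add: algebra_simps del: legendre.simps)
  next
    case 2
    have "x * ?D (Suc (Suc n)) - ?D (Suc n) = (real n + 2) * ?P (Suc (Suc n))"
      using a B Suc by algebra
    then show ?case by (simp add: algebra_simps del: legendre.simps)
  }
qed

text \<open>Truncated subtraction does no harm at \<open>n = 0\<close>, where both sides
  vanish.\<close>

lemma legendre_deriv_pred:
  "x * poly (pderiv (legendre n)) x - poly (pderiv (legendre (n - 1))) x = real n * poly (legendre n) x"
  using poly_pderiv_legendre(2)[of x "n - 1"] by (cases n) (simp_all add: add.commute)

lemma legendre_deriv_mult:
  "(x\<^sup>2 - 1) * poly (pderiv (legendre n)) x =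
     real n * (x * poly (legendre n) x - poly (legendre (n - 1)) x)"
proof (cases n)
  case (Suc m)
  have "(x\<^sup>2 - 1) * poly (pderiv (legendre (Suc m))) x =
     (real m + 1) * (x * poly (legendre (Suc m)) x - poly (legendre m) x)"
    using poly_pderiv_legendre[where n = m and x = x] by algebra
  then show ?thesis using Suc by (simp add: add.commute)
qed simp

section \<open>Integrals over [-1, 1], orthogonality and \<open>L^2\<close> norms\<close>

lemma poly_has_integral_pderiv:
  fixes p :: "real poly"
  assumes "a \<le> b"
  shows "(poly (pderiv p) has_integral (poly p b - poly p a)) {a..b}"
  using assms
  by (intro fundamental_theorem_of_calculus)
     (auto intro!: DERIV_subset[OF poly_DERIV] simp flip: has_real_derivative_iff_has_vector_derivative)

lemma poly_integrable [simp, intro]: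
  fixes p :: "real poly"
  shows "poly p integrable_on {a..b}"
  by (intro integrable_continuous_real continuous_on_poly continuous_on_id)

definition poly_int :: "real poly \<Rightarrow> real" where
  "poly_int p = integral {-1..1} (poly p)"

lemma poly_int_0 [simp]: "poly_int 0 = 0"
  by (simp add: poly_int_def poly_0[abs_def])

lemma poly_int_add: "poly_int (p + q) = poly_int p + poly_int q"
  using integral_add[OF poly_integrable[of p] poly_integrable[of q]]
  by (simp add: poly_int_def poly_add[abs_def])

lemma poly_int_smult: "poly_int (smult c p) = c * poly_int p"
  by (simp add: poly_int_def poly_smult[abs_def])

lemma poly_int_sum: "poly_int (\<Sum>i\<in>A. f i) = (\<Sum>i\<in>A. poly_int (f i))"
  by (induction A rule: infinite_finite_induct) (simp_all add: poly_int_add)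

lemma poly_int_pderiv: "poly_int (pderiv p) = poly p 1 - poly p (-1)"
  unfolding poly_int_def by (rule integral_unique[OF poly_has_integral_pderiv]) simp

lemma poly_int_mono: "(\<And>x. poly p x \<le> poly q x) \<Longrightarrow> poly_int p \<le> poly_int q"
  unfolding poly_int_def by (rule integral_le) auto

text \<open>Sturm-Liouville argument: \<open>W\<close> is the Wronskian of the two polynomials
  weighted by \<open>x^2 - 1\<close>. It vanishes at both endpoints, and its derivative is the
  product times the difference \<open>?c\<close> of the eigenvalues \<open>k * (k + 1)\<close>,
  which is nonzero for distinct indices.\<close>

lemma poly_int_legendre_mult_eq_0:
  assumes "m \<noteq> n"
  shows "poly_int (legendre m * legendre n) = 0"
proof -
  let ?P = "\<lambda>n. poly (legendre n)" and ?D = "\<lambda>n. poly (pderiv (legendre n))"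
  let ?c = "real m * (real m + 1) - real n * (real n + 1)"
  \<comment> \<open>In this derivative-free form of \<open>(x^2 - 1) * ?D k x\<close>, computing
    \<open>pderiv (Q k)\<close> involves no second derivatives.\<close>
  define Q where "Q k = smult (real k) ([:0, 1:] * legendre k - legendre (k - 1))" for k
  define W where "W = Q m * legendre n - Q n * legendre m"
  have Q: "poly (Q k) x = (x\<^sup>2 - 1) * ?D k x" for k x
    unfolding Q_def legendre_deriv_mult by (simp add: algebra_simps)
  have Q': "poly (pderiv (Q k)) x = real k * (real k + 1) * ?P k x" for k x
  proof -
    have "poly (pderiv (Q k)) x = real k * (?P k x + x * ?D k x - ?D (k - 1) x)"
      by (simp add: Q_def pderiv_smult pderiv_diff pderiv_mult pderiv_pCons del: mult_pCons_left)
    then show ?thesis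
      using legendre_deriv_pred[of x k] by algebra
  qed
  have "pderiv W = smult ?c (legendre m * legendre n)"
  proof (rule poly_ext)
    fix x
    show "poly (pderiv W) x = poly (smult ?c (legendre m * legendre n)) x"
      unfolding W_def pderiv_diff pderiv_mult poly_diff poly_add poly_mult poly_smult Q Q'
      by algebra
  qed
  then have "?c * poly_int (legendre m * legendre n) = poly W 1 - poly W (-1)"
    by (metis poly_int_pderiv poly_int_smult)
  also have "\<dots> = 0"
    by (simp add: W_def Q)
  finally have "?c * poly_int (legendre m * legendre n) = 0" .
  moreover have "?c = (real m - real n) * (real m + real n + 1)"
    by (simp add: algebra_simps)
  ultimately show ?thesis
    using assms by auto
qed

text \<open>Since the leading coefficient of \<open>legendre (Suc n)\<close> is positive, a multiple
  of it cancels the top term of \<open>p\<close>, and induction handles the rest.\<close>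

lemma legendre_expansion:
  assumes "degree p \<le> n"
  obtains a where "p = (\<Sum>k\<le>n. smult (a k) (legendre k))"
proof -
  have "\<exists>a. p = (\<Sum>k\<le>n. smult (a k) (legendre k))"
    using assms
  proof (induction n arbitrary: p)
    case 0
    then obtain c where "p = [:c:]" by (auto elim: degree_eq_zeroE)
    then show ?case by (intro exI[of _ "\<lambda>_. c"]) (simp add: smult_one)
  next
    case (Suc n)
    define c where "c = coeff p (Suc n) / coeff (legendre (Suc n)) (Suc n)"
    have "degree (p - smult c (legendre (Suc n))) \<le> n"
    proof (rule degree_le, intro allI impI)
      fix i assume "n < i"
      show "coeff (p - smult c (legendre (Suc n))) i = 0"
      proof (cases "i = Suc n")
        case True
        then show ?thesis using coeff_legendre_pos[of "Suc n"] by (simp add: c_def)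
      next
        case False
        then show ?thesis
          using \<open>n < i\<close> Suc.prems degree_legendre_le[of "Suc n"] by (simp add: coeff_eq_0)
      qed
    qed
    then obtain a where a: "p - smult c (legendre (Suc n)) = (\<Sum>k\<le>n. smult (a k) (legendre k))"
      using Suc.IH by blast
    have "p = (\<Sum>k\<le>Suc n. smult ((a(Suc n := c)) k) (legendre k))"
      using a by (simp add: algebra_simps del: legendre.simps)
    then show ?case by blast
  qed
  then show ?thesis using that by blast
qed

lemma poly_int_mult_legendre_eq_0:
  assumes "degree q < n"
  shows "poly_int (q * legendre n) = 0"
proof -
  obtain a where q: "q = (\<Sum>k\<le>n - 1. smult (a k) (legendre k))"
    using legendre_expansion[of q "n - 1"] assms by (metis Suc_diff_1 less_Suc_eq_le not_less_zero neq0_conv)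
  then have "poly_int (q * legendre n) =
      (\<Sum>k\<le>n - 1. a k * poly_int (legendre k * legendre n))"
    by (simp add: q sum_distrib_right poly_int_sum poly_int_smult)
  also have "\<dots> = 0"
    using assms by (intro sum.neutral ballI) (subst poly_int_legendre_mult_eq_0, auto)
  finally show ?thesis .
qed

text \<open>Integrate the derivative of \<open>x * P_n^2\<close>. The boundary values give 2; by
  \<open>x * P_n' = n * P_n + P_(n-1)'\<close> the integrand is \<open>(2n+1) * P_n^2\<close> plus a
  multiple of \<open>P_(n-1)' * P_n\<close>, which integrates to 0 because of its lower-degree
  factor.\<close>

lemma poly_int_legendre_square: "poly_int (legendre n * legendre n) = 2 / (2 * real n + 1)"
proof -
  have "poly_int (pderiv (legendre (n - 1)) * legendre n) = 0"
  proof (cases "n = 0")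
    case False
    then show ?thesis
      using degree_legendre_le[of "n - 1"]
      by (intro poly_int_mult_legendre_eq_0) (simp add: degree_pderiv)
  qed simp
  moreover have eq: "pderiv ([:0, 1:] * (legendre n * legendre n)) =
      smult (2 * real n + 1) (legendre n * legendre n) + smult 2 (pderiv (legendre (n - 1)) * legendre n)"
  proof (rule poly_ext)
    fix x
    have "poly (pderiv ([:0, 1:] * (legendre n * legendre n))) x =
        poly (legendre n) x * poly (legendre n) x + 2 * x * poly (pderiv (legendre n)) x * poly (legendre n) x"
      by (simp add: pderiv_mult pderiv_pCons algebra_simps del: mult_pCons_left)
    then show "poly (pderiv ([:0, 1:] * (legendre n * legendre n))) x =
        poly (smult (2 * real n + 1) (legendre n * legendre n) + smult 2 (pderiv (legendre (n - 1)) * legendre n)) x"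
      using legendre_deriv_pred[of x n] unfolding poly_add poly_smult poly_mult by algebra
  qed
  moreover have "poly_int (pderiv ([:0, 1:] * (legendre n * legendre n))) = 2"
        by (simp add: poly_int_pderiv poly_legendre_1 poly_legendre_minus_1 flip: power_mult_distrib)
  ultimately have "(2 * real n + 1) * poly_int (legendre n * legendre n) = 2"
    by (simp add: poly_int_add poly_int_smult)
  then show ?thesis by (simp add: field_simps)
qed

lemma poly_pderiv_legendre_1: "poly (pderiv (legendre n)) 1 = real n * (real n + 1) / 2"
  by (induction n) (simp_all add: poly_pderiv_legendre(1) poly_legendre_1 field_simps del: legendre.simps(2,3))

lemma poly_pderiv_legendre_minus_1:
  "poly (pderiv (legendre n)) (-1) = - ((-1) ^ n * (real n * (real n + 1) / 2))"
  by (induction n)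
     (simp_all add: poly_pderiv_legendre(1) poly_legendre_minus_1 field_simps del: legendre.simps(2,3))

text \<open>Integration by parts: the second derivative has lower degree, hence is orthogonal to
  \<open>legendre n\<close>, and only the boundary values remain.\<close>

lemma poly_int_pderiv_legendre_square:
  "poly_int (pderiv (legendre n) * pderiv (legendre n)) = real n * (real n + 1)"
proof -
  let ?D = "pderiv (legendre n)"
  have "poly_int (pderiv ?D * legendre n) = 0"
  proof (cases "n = 0")
    case False
    then show ?thesis
      using degree_legendre_le[of n]
      by (intro poly_int_mult_legendre_eq_0) (simp add: degree_pderiv)
  qed simp
  moreover have "pderiv (?D * legendre n) = ?D * ?D + pderiv ?D * legendre n"
    by (simp add: pderiv_mult)
  moreover have "poly_int (pderiv (?D * legendre n)) = real n * (real n + 1)"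
        by (cases "even n") (simp_all add: poly_int_pderiv poly_legendre_1 poly_legendre_minus_1
        poly_pderiv_legendre_1 poly_pderiv_legendre_minus_1)
  ultimately show ?thesis
    by (simp add: poly_int_add)
qed

section \<open>Growth outside the interval, and the \<open>L^2\<close> Markov inequality\<close>

text \<open>To the right of 1 the ratio of consecutive values stays between 1 and \<open>w\<close>;
  both bounds and positivity are needed together to feed Bonnet's recurrence.\<close>

lemma legendre_bounds:
  assumes w: "1 \<le> w" and x: "x = (w + 1 / w) / 2"
  shows "0 < poly (legendre n) x" "poly (legendre n) x \<le> poly (legendre (Suc n)) x"
    "poly (legendre (Suc n)) x \<le> w * poly (legendre n) x"
proof -
  let ?P = "\<lambda>n. poly (legendre n) x"
  have wx: "2 * x * w = w * w + 1"
    using w by (simp add: x field_simps)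
  have "(w - 1) * (w - 1) \<ge> 0" by simp
  then have x1: "x \<ge> 1" using w by (simp add: x field_simps)
  have xw: "x \<le> w"
  proof -
    have "1 * 1 \<le> w * w" using w by (intro mult_mono) auto
    then show ?thesis using w by (simp add: x field_simps)
  qed
  have "0 < ?P n \<and> ?P n \<le> ?P (Suc n) \<and> ?P (Suc n) \<le> w * ?P n"
  proof (induction n)
    case 0
    then show ?case using x1 xw by simp
  next
    case (Suc n)
    then have IH: "0 < ?P n" "?P n \<le> ?P (Suc n)" "?P (Suc n) \<le> w * ?P n" by auto
    then have pos: "0 < ?P (Suc n)" by linarith
    have "(2 * real n + 3) * ?P (Suc n) \<le> (2 * real n + 3) * x * ?P (Suc n)"
      using x1 pos by simp
    moreover have "(real n + 1) * ?P n \<le> (real n + 1) * ?P (Suc n)"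
      using IH by (intro mult_left_mono) auto
    ultimately have "(real n + 2) * ?P (Suc n) \<le> (real n + 2) * ?P (Suc (Suc n))"
      unfolding legendre_bonnet by (simp add: algebra_simps del: legendre.simps)
    then have lower: "?P (Suc n) \<le> ?P (Suc (Suc n))" by (simp del: legendre.simps)
    \<comment> \<open>The factor \<open>2 * w\<close> clears the fraction in \<open>x\<close>,
      because \<open>2 * x * w = w * w + 1\<close>. Replacing \<open>w * ?P n\<close> by the smaller
      \<open>?P (Suc n)\<close> then leaves the slack \<open>(w * w - 1) * ?P (Suc n)\<close>, which
      is nonnegative.\<close>
    have "(2 * w) * ((real n + 2) * ?P (Suc (Suc n))) =
        (2 * real n + 3) * (w * w + 1) * ?P (Suc n) - 2 * (real n + 1) * (w * ?P n)"
      unfolding legendre_bonnet wx[symmetric] by (simp add: algebra_simps del: legendre.simps)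
    also have "\<dots> \<le> (2 * real n + 3) * (w * w + 1) * ?P (Suc n) - 2 * (real n + 1) * ?P (Suc n)"
      using IH(3) by (intro diff_left_mono mult_left_mono) auto
    also have "\<dots> = (2 * w) * ((real n + 2) * (w * ?P (Suc n))) - (w * w - 1) * ?P (Suc n)"
      by (simp add: algebra_simps del: legendre.simps)
    also have "\<dots> \<le> (2 * w) * ((real n + 2) * (w * ?P (Suc n)))"
      using pos mult_mono[of 1 w 1 w] w by simp
    finally have "?P (Suc (Suc n)) \<le> w * ?P (Suc n)"
      using w by (simp del: legendre.simps)
    with pos lower show ?case by blast
  qed
  then show "0 < ?P n" "?P n \<le> ?P (Suc n)" "?P (Suc n) \<le> w * ?P n" by auto
qed

lemma abs_legendre_le_power:
  assumes w: "1 \<le> w" and x: "x = (w + 1 / w) / 2"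
  shows "\<bar>poly (legendre n) x\<bar> \<le> w ^ n"
proof -
  have "poly (legendre n) x \<le> w ^ n"
  proof (induction n)
    case (Suc n)
    then have "w * poly (legendre n) x \<le> w * w ^ n"
      using w by (intro mult_left_mono) auto
    then show ?case
      using legendre_bounds(3)[OF w x, of n] unfolding power_Suc by (rule order.trans[rotated])
  qed simp
  then show ?thesis
    using legendre_bounds(1)[OF w x, of n] by (simp only: abs_of_pos)
qed

lemma poly_int_legendre_sum_square:
  "poly_int ((\<Sum>k\<le>n. smult (a k) (legendre k)) * (\<Sum>k\<le>n. smult (a k) (legendre k))) =
     (\<Sum>k\<le>n. (a k)\<^sup>2 * (2 / (2 * real k + 1)))"
proof -
  have "poly_int ((\<Sum>k\<le>n. smult (a k) (legendre k)) * (\<Sum>k\<le>n. smult (a k) (legendre k))) =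
      (\<Sum>j\<le>n. \<Sum>k\<le>n. a j * a k * poly_int (legendre j * legendre k))"
    by (simp add: sum_product poly_int_sum poly_int_smult mult.assoc mult.left_commute mult.commute)
  also have "\<dots> = (\<Sum>j\<le>n. \<Sum>k\<le>n. if k = j then (a j)\<^sup>2 * (2 / (2 * real j + 1)) else 0)"
    by (intro sum.cong refl) (auto simp: poly_int_legendre_mult_eq_0 poly_int_legendre_square power2_eq_square)
  finally show ?thesis by simp
qed

lemma pderiv_sum: "pderiv (\<Sum>i\<in>A. f i) = (\<Sum>i\<in>A. pderiv (f i))"
  by (induction A rule: infinite_finite_induct) (simp_all add: pderiv_add)

text \<open>With \<open>c k\<close> the value at a point of the \<open>k\<close>-th Legendre polynomial or of its derivative, this bounds
  point values of a polynomial or of its derivative by its \<open>L\<^sup>2\<close> norm.\<close>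
lemma legendre_cauchy_schwarz:
  "(\<Sum>k\<le>n. a k * c k)\<^sup>2 \<le>
     poly_int ((\<Sum>k\<le>n. smult (a k) (legendre k)) * (\<Sum>k\<le>n. smult (a k) (legendre k))) *
     (\<Sum>k\<le>n. (2 * real k + 1) / 2 * (c k)\<^sup>2)"
proof -
  \<comment> \<open>\<open>?s k\<close> is the \<open>L^2\<close> norm of the \<open>k\<close>-th
    Legendre polynomial on [-1, 1].\<close>
  let ?s = "\<lambda>k. sqrt (2 / (2 * real k + 1))"
  have s: "?s k > 0" "(?s k)\<^sup>2 = 2 / (2 * real k + 1)" for k by simp_all
  have "(\<Sum>k\<le>n. a k * c k) = (\<Sum>k\<le>n. (a k * ?s k) * (c k / ?s k))"
    using s(1) by (intro sum.cong refl) (simp add: less_imp_neq[THEN not_sym])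
  then have "(\<Sum>k\<le>n. a k * c k)\<^sup>2 \<le> (\<Sum>k\<le>n. (a k * ?s k)\<^sup>2) * (\<Sum>k\<le>n. (c k / ?s k)\<^sup>2)"
    by (simp only: Cauchy_Schwarz_ineq_sum)
  also have "(\<Sum>k\<le>n. (a k * ?s k)\<^sup>2) = (\<Sum>k\<le>n. (a k)\<^sup>2 * (2 / (2 * real k + 1)))"
    by (simp add: power_mult_distrib s)
  also have "(\<Sum>k\<le>n. (c k / ?s k)\<^sup>2) = (\<Sum>k\<le>n. (2 * real k + 1) / 2 * (c k)\<^sup>2)"
    by (simp add: power_divide s mult.commute)
  finally show ?thesis
    by (simp only: poly_int_legendre_sum_square)
qed

text \<open>The weights \<open>(2k+1)/2\<close> are replaced by the largest one and the values by
  powers of \<open>w\<close>; summing the geometric series in \<open>w^2\<close> produces the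
  denominator \<open>w^2 - 1\<close>, which becomes the square root in the final bound.\<close>

lemma poly_square_le_poly_int:
  assumes "degree p \<le> n" and w: "1 < w" and x: "x = (w + 1 / w) / 2"
  shows "(poly p x)\<^sup>2 \<le> poly_int (p * p) * ((2 * real n + 1) / 2 * (w\<^sup>2 ^ (n + 1) / (w\<^sup>2 - 1)))"
proof -
  obtain a where p: "p = (\<Sum>k\<le>n. smult (a k) (legendre k))"
    using legendre_expansion assms(1) by blast
  have nonneg: "0 \<le> poly_int (p * p)"
    using poly_int_mono[of 0 "p * p"] by simp
  have w2: "w\<^sup>2 > 1" using w by (simp add: one_less_power)
  have "poly p x = (\<Sum>k\<le>n. a k * poly (legendre k) x)"
    by (simp add: p poly_sum)
  then have "(poly p x)\<^sup>2 \<le> poly_int (p * p) * (\<Sum>k\<le>n. (2 * real k + 1) / 2 * (poly (legendre k) x)\<^sup>2)"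
    using legendre_cauchy_schwarz[where a = a and n = n] unfolding p by simp
  also have "\<dots> \<le> poly_int (p * p) * (\<Sum>k\<le>n. (2 * real n + 1) / 2 * w\<^sup>2 ^ k)"
  proof (intro mult_left_mono sum_mono mult_mono nonneg)
    fix k
    have "\<bar>poly (legendre k) x\<bar>\<^sup>2 \<le> (w ^ k)\<^sup>2"
      using abs_legendre_le_power[OF _ x, of k] w by (intro power_mono) simp_all
    then show "(poly (legendre k) x)\<^sup>2 \<le> w\<^sup>2 ^ k"
      by (simp add: power_even_eq[symmetric] power_mult[symmetric] mult.commute)
  qed auto
  also have "\<dots> = poly_int (p * p) * ((2 * real n + 1) / 2 * ((w\<^sup>2 ^ (n + 1) - 1) / (w\<^sup>2 - 1)))"
    using w2 geometric_sum[of "w\<^sup>2" "n + 1"]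
    by (simp only: sum_distrib_left[symmetric] lessThan_Suc_atMost Suc_eq_plus1[symmetric])
  also have "\<dots> \<le> poly_int (p * p) * ((2 * real n + 1) / 2 * (w\<^sup>2 ^ (n + 1) / (w\<^sup>2 - 1)))"
    using w2 nonneg by (intro mult_left_mono divide_right_mono) auto
  finally show ?thesis .
qed

text \<open>Cauchy-Schwarz bounds the squared derivative pointwise by the squared \<open>L^2\<close>
  norm of \<open>p\<close> times \<open>q\<close>; integrating \<open>q\<close> leaves a sum of
  known norms with a closed form.\<close>

lemma poly_int_pderiv_square_le:
  assumes "degree p \<le> n"
  shows "poly_int (pderiv p * pderiv p) \<le> 3 * real n ^ 4 * poly_int (p * p)"
proof -
  obtain a where p: "p = (\<Sum>k\<le>n. smult (a k) (legendre k))"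
    using legendre_expansion assms by blast
  have nonneg: "0 \<le> poly_int (p * p)"
    using poly_int_mono[of 0 "p * p"] by simp
  define q where "q = (\<Sum>k\<le>n. smult ((2 * real k + 1) / 2) (pderiv (legendre k) * pderiv (legendre k)))"
  have "poly_int (pderiv p * pderiv p) \<le> poly_int (smult (poly_int (p * p)) q)"
  proof (rule poly_int_mono)
    fix x
    have "poly (pderiv p) x = (\<Sum>k\<le>n. a k * poly (pderiv (legendre k)) x)"
      by (simp add: p poly_sum pderiv_sum pderiv_smult)
    then show "poly (pderiv p * pderiv p) x \<le> poly (smult (poly_int (p * p)) q) x"
      using legendre_cauchy_schwarz[where a = a and n = n and c = "\<lambda>k. poly (pderiv (legendre k)) x"]
      by (simp add: p[symmetric] q_def poly_sum power2_eq_square)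
  qed
  also have "\<dots> = poly_int (p * p) * (\<Sum>k\<le>n. (2 * real k + 1) / 2 * (real k * (real k + 1)))"
    by (simp add: q_def poly_int_smult poly_int_sum poly_int_pderiv_legendre_square)
  also have "(\<Sum>k\<le>n. (2 * real k + 1) / 2 * (real k * (real k + 1))) =
      real n * (real n + 1)\<^sup>2 * (real n + 2) / 4"
    by (induction n) (simp_all add: field_simps power2_eq_square)
  also have "poly_int (p * p) * \<dots> \<le> poly_int (p * p) * (3 * real n ^ 4)"
  proof (intro mult_left_mono nonneg, cases "n = 0")
    case False
    then have n: "real n \<ge> 1" by simp
    \<comment> \<open>For \<open>n \<ge> 1\<close>, \<open>n + 1 \<le> 2n\<close> and
      \<open>n + 2 \<le> 3n\<close>, hence the constant \<open>4 * 3 / 4 = 3\<close>.\<close>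
    have "real n * (real n + 1)\<^sup>2 * (real n + 2) \<le> real n * (real n + real n)\<^sup>2 * (real n + 2 * real n)"
      using n by (intro mult_mono power_mono) auto
    then show "real n * (real n + 1)\<^sup>2 * (real n + 2) / 4 \<le> 3 * real n ^ 4"
      by (simp add: power2_eq_square power4_eq_xxxx)
  qed simp
  finally show ?thesis
    by (simp only: mult.commute)
qed

section \<open>Equispaced sampling of polynomials\<close>

text \<open>The derivative of \<open>(x - ?m) * g\<close>, with \<open>?m\<close> the midpoint,
  integrates exactly to the trapezoidal value; what is left is \<open>(x - ?m) * g'\<close>, where
  \<open>x - ?m\<close> is at most half the length. The majorant \<open>G\<close> keeps the
  integrands polynomial.\<close>

lemma poly_trapezoid_le:
  fixes g G :: "real poly"
  assumes ab: "a \<le> b" and G: "\<And>x. \<bar>poly (pderiv g) x\<bar> \<le> poly G x"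
  shows "integral {a..b} (poly g) \<le>
    (b - a) / 2 * (poly g a + poly g b) + (b - a) / 2 * integral {a..b} (poly G)"
proof -
  let ?m = "(a + b) / 2"
  define H where "H = [:- ?m, 1:] * g"
  have "integral {a..b} (poly g) \<le> integral {a..b} (\<lambda>x. poly (pderiv H) x + (b - a) / 2 * poly G x)"
  proof (rule integral_le)
    fix x assume x: "x \<in> {a..b}"
    have "- ((x - ?m) * poly (pderiv g) x) \<le> \<bar>x - ?m\<bar> * \<bar>poly (pderiv g) x\<bar>"
      by (metis abs_ge_minus_self abs_mult)
    also have "\<dots> \<le> (b - a) / 2 * poly G x"
      using x by (intro mult_mono G) (auto simp: abs_le_iff field_simps)
    finally have "poly g x \<le> (poly g x + (x - ?m) * poly (pderiv g) x) + (b - a) / 2 * poly G x"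
      by linarith
    also have "poly g x + (x - ?m) * poly (pderiv g) x = poly (pderiv H) x"
      unfolding H_def by (subst pderiv_mult) (simp add: pderiv_pCons left_diff_distrib)
    finally show "poly g x \<le> poly (pderiv H) x + (b - a) / 2 * poly G x" .
  qed (auto intro!: integrable_add integrable_on_mult_right)
  also have "\<dots> = integral {a..b} (poly (pderiv H)) + (b - a) / 2 * integral {a..b} (poly G)"
    by (subst integral_add) (auto intro!: integrable_on_mult_right)
  also have "integral {a..b} (poly (pderiv H)) = poly H b - poly H a"
    by (intro integral_unique poly_has_integral_pderiv ab)
  also have "\<dots> = (b - a) / 2 * (poly g a + poly g b)"
    by (simp add: H_def field_simps)
  finally show ?thesis .
qed

text \<open>The subtracted term gives the last node its weight one half, so that the next panel
  completes it in the induction. The first node keeps full weight, an overestimate since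
  \<open>g\<close> is nonnegative.\<close>

lemma poly_composite_trapezoid_le:
  fixes g G :: "real poly"
  assumes h: "h \<ge> 0" and g: "\<And>x. 0 \<le> poly g x" and G: "\<And>x. \<bar>poly (pderiv g) x\<bar> \<le> poly G x"
  shows "integral {a..a + real N * h} (poly g) \<le>
    h * (\<Sum>k\<le>N. poly g (a + real k * h)) - h / 2 * poly g (a + real N * h) +
      h / 2 * integral {a..a + real N * h} (poly G)"
proof (induction N)
  case 0
  then show ?case using h g[of a] by simp
next
  case (Suc N)
  let ?b = "a + real N * h" and ?c = "a + real (Suc N) * h"
  have *: "integral {a..?c} (poly p) = integral {a..?b} (poly p) + integral {?b..?c} (poly p)" for p :: "real poly"
    using h Henstock_Kurzweil_Integration.integral_combine[of a ?b ?c "poly p"] by (simp add: algebra_simps)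
  have bc: "?c - ?b = h" by (simp add: algebra_simps)
  have "integral {?b..?c} (poly g) \<le> h / 2 * (poly g ?b + poly g ?c) + h / 2 * integral {?b..?c} (poly G)"
    using poly_trapezoid_le[of ?b ?c g G] G h unfolding bc by (simp add: algebra_simps)
  then show ?case
    using Suc unfolding * by (simp add: algebra_simps)
qed

text \<open>For \<open>p * p\<close> the error of the trapezoidal rule is at most
  \<open>7 / 8\<close> of the integral itself. Absorbing it on the left costs a factor 8, which
  turns the step \<open>2 / N\<close> into \<open>16 / N\<close>.\<close>

lemma poly_int_square_le_sample:
  fixes p :: "real poly"
  assumes deg: "degree p \<le> n" and N: "N > 0" and n: "4 * (real n)\<^sup>2 \<le> real N"
  shows "poly_int (p * p) \<le> 16 / real N * (\<Sum>k\<le>N. (poly p (-1 + real k * (2 / real N)))\<^sup>2)"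
proof -
  define G where "G = smult (real N / 2) (p * p) + smult (2 / real N) (pderiv p * pderiv p)"
  \<comment> \<open>AM-GM, with the weight that makes both terms of the integral of \<open>G\<close> of order \<open>N\<close>\<close>
  have G: "\<bar>poly (pderiv (p * p)) x\<bar> \<le> poly G x" for x
  proof -
    have "0 \<le> (real N / 2 * poly p x + poly (pderiv p) x)\<^sup>2" "0 \<le> (real N / 2 * poly p x - poly (pderiv p) x)\<^sup>2"
      by simp_all
    then show ?thesis
      using N by (auto simp: abs_le_iff G_def pderiv_mult field_simps power2_eq_square)
  qed
  have nonneg: "0 \<le> poly_int (p * p)"
    using poly_int_mono[of 0 "p * p"] by simp
  have N2: "-1 + real N * (2 / real N) = 1" using N by simp
  have last: "0 \<le> 2 / real N / 2 * poly (p * p) 1" by simp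
  have "poly_int G = real N / 2 * poly_int (p * p) + 2 / real N * poly_int (pderiv p * pderiv p)"
    by (simp add: G_def poly_int_add poly_int_smult)
  \<comment> \<open>Squaring \<open>4 n^2 \<le> N\<close> gives \<open>16 n^4 \<le> N^2\<close>, so
    Markov's \<open>3 n^4\<close> is at most \<open>3 N^2 / 16\<close>.\<close>
  also have "\<dots> \<le> real N / 2 * poly_int (p * p) + 2 / real N * (3 * (real N)\<^sup>2 / 16 * poly_int (p * p))"
  proof -
    have "(4 * (real n)\<^sup>2)\<^sup>2 \<le> (real N)\<^sup>2"
      using n by (intro power_mono) auto
    then have "3 * real n ^ 4 * poly_int (p * p) \<le> 3 * (real N)\<^sup>2 / 16 * poly_int (p * p)"
      using nonneg by (intro mult_right_mono) (auto simp: power_mult_distrib)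
    then show ?thesis
      using poly_int_pderiv_square_le[OF deg]
        by (intro add_left_mono mult_left_mono order.trans[OF _ \<open>_ \<le> 3 * (real N)\<^sup>2 / 16 * _\<close>]) simp_all
  qed
  finally have "2 / real N / 2 * poly_int G \<le>
      2 / real N / 2 * (real N / 2 * poly_int (p * p) + 2 / real N * (3 * (real N)\<^sup>2 / 16 * poly_int (p * p)))"
    by (intro mult_left_mono) auto
  \<comment> \<open>The two terms contribute \<open>1 / 2\<close> and \<open>3 / 8\<close>.\<close>
  also have "\<dots> = 7 / 8 * poly_int (p * p)"
    using N by (simp add: field_simps power2_eq_square)
  finally have "2 / real N / 2 * poly_int G \<le> 7 / 8 * poly_int (p * p)" .
  moreover have "poly_int (p * p) \<le> 2 / real N * (\<Sum>k\<le>N. poly (p * p) (-1 + real k * (2 / real N))) +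
      2 / real N / 2 * poly_int G"
    using poly_composite_trapezoid_le[of "2 / real N" "p * p" G "-1" N] G
      last
    unfolding N2 poly_int_def[symmetric] by (smt (verit) divide_nonneg_nonneg of_nat_0_le_iff poly_mult zero_le_square)
  ultimately have "poly_int (p * p) \<le> 8 * (2 / real N * (\<Sum>k\<le>N. poly (p * p) (-1 + real k * (2 / real N))))"
    by linarith
  then show ?thesis
    by (simp add: power2_eq_square)
qed

section \<open>Chebyshev approximation on the Bernstein ellipse\<close>

lemma bernstein_ellipse_axes_pos:
  fixes \<rho> :: real
  assumes "\<rho> > 1"
  shows "(\<rho> + 1 / \<rho>) / 2 > 0" "(\<rho> - 1 / \<rho>) / 2 > 0"
proof -
  have "0 < \<rho>" using assms by linarith
  then have "0 < 1 / \<rho>" "1 / \<rho> < 1" using assms by simp_all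
  then have "\<rho> + 1 / \<rho> > 0" "\<rho> - 1 / \<rho> > 0" using assms by (linarith, linarith)
  then show "(\<rho> + 1 / \<rho>) / 2 > 0" "(\<rho> - 1 / \<rho>) / 2 > 0" by simp_all
qed

text \<open>Through this linear map the ellipse inherits convexity, boundedness and its boundary
  points from the unit disc.\<close>

lemma ellipse_eq_image_ball:
  assumes "a > 0" "b > 0"
  shows "{z. (Re z / a)\<^sup>2 + (Im z / b)\<^sup>2 < 1} = (\<lambda>z. Complex (a * Re z) (b * Im z)) ` ball 0 1"
proof -
  have "(\<lambda>z. Complex (a * Re z) (b * Im z)) ` ball 0 1 =
      (\<lambda>z. Complex (a * Re z) (b * Im z)) ` {z. (Re z)\<^sup>2 + (Im z)\<^sup>2 < 1}"
    by (simp add: ball_def dist_norm cmod_def)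
  also have "\<dots> = {z. (Re z / a)\<^sup>2 + (Im z / b)\<^sup>2 < 1}"
  proof (intro equalityI subsetI)
    fix z assume "z \<in> {z. (Re z / a)\<^sup>2 + (Im z / b)\<^sup>2 < 1}"
    then show "z \<in> (\<lambda>z. Complex (a * Re z) (b * Im z)) ` {z. (Re z)\<^sup>2 + (Im z)\<^sup>2 < 1}"
      using assms by (intro image_eqI[of _ _ "Complex (Re z / a) (Im z / b)"]) auto
  qed (use assms in auto)
  finally show ?thesis ..
qed

lemma bernstein_ellipse_eq_image_ball:
  assumes "\<rho> > 1"
  shows "bernstein_ellipse \<rho> =
    (\<lambda>z. Complex ((\<rho> + 1 / \<rho>) / 2 * Re z) ((\<rho> - 1 / \<rho>) / 2 * Im z)) ` ball 0 1"
  unfolding bernstein_ellipse_def by (intro ellipse_eq_image_ball bernstein_ellipse_axes_pos assms)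

lemma linear_Complex_scale: "linear (\<lambda>z. Complex (a * Re z) (b * Im z))"
  by (rule linearI) (auto simp: complex_eq_iff algebra_simps)

lemma open_bernstein_ellipse: "open (bernstein_ellipse \<rho>)"
  unfolding bernstein_ellipse_def divide_inverse by (intro open_Collect_less continuous_intros)

lemma convex_bernstein_ellipse: "\<rho> > 1 \<Longrightarrow> convex (bernstein_ellipse \<rho>)"
  by (subst bernstein_ellipse_eq_image_ball, assumption) (intro convex_linear_image linear_Complex_scale convex_ball)

lemma bounded_bernstein_ellipse: "\<rho> > 1 \<Longrightarrow> bounded (bernstein_ellipse \<rho>)"
  by (subst bernstein_ellipse_eq_image_ball, assumption) (intro bounded_linear_image linear_Complex_scale[unfolded linear_conv_bounded_linear] bounded_ball)

lemma of_real_in_bernstein_ellipse: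
  assumes "\<rho> > 1" "\<bar>x\<bar> < (\<rho> + 1 / \<rho>) / 2"
  shows "complex_of_real x \<in> bernstein_ellipse \<rho>"
proof -
  have "\<bar>x / ((\<rho> + 1 / \<rho>) / 2)\<bar> = \<bar>x\<bar> / ((\<rho> + 1 / \<rho>) / 2)"
    using bernstein_ellipse_axes_pos(1)[OF assms(1)] by (metis abs_divide abs_of_pos)
  also have "\<dots> < 1"
    using bernstein_ellipse_axes_pos(1)[OF assms(1)] assms(2) by (subst divide_less_eq_1_pos)
  finally have "(x / ((\<rho> + 1 / \<rho>) / 2))\<^sup>2 < 1"
    by (subst abs_square_less_1)
  then show ?thesis
    by (simp add: bernstein_ellipse_def)
qed

text \<open>For \<open>y = z / \<rho>\<close> on the unit circle,
  \<open>1 / z = cnj y / \<rho>\<close>, so the point is the linear image \<open>?L y\<close>. It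
  lies in the closure as the image of a point of the closed disc, and outside the open ellipse
  because the defining inequality becomes an equality.\<close>

lemma joukowski_in_frontier:
  assumes "\<rho> > 1" "norm z = \<rho>"
  shows "(z + 1 / z) / 2 \<in> frontier (bernstein_ellipse \<rho>)"
proof -
  define a b where "a = (\<rho> + 1 / \<rho>) / 2" and "b = (\<rho> - 1 / \<rho>) / 2"
  have ab: "a > 0" "b > 0"
    unfolding a_def b_def using bernstein_ellipse_axes_pos[OF assms(1)] .
  let ?L = "\<lambda>z. Complex (a * Re z) (b * Im z)"
  define y where "y = z / of_real \<rho>"
  have y: "norm y = 1"
    using assms by (simp add: y_def norm_divide)
  have z: "z = of_real \<rho> * y"
    using assms by (simp add: y_def)
  have "cnj y * y = 1"
    using complex_norm_square[of y] y by (simp add: mult.commute)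
  then have "1 / y = cnj y"
    using y by (metis div_by_0 nonzero_eq_divide_eq norm_zero zero_neq_one)
  then have "1 / z = cnj y / of_real \<rho>"
    by (metis z divide_divide_eq_left mult.commute)
  then have eq: "(z + 1 / z) / 2 = ?L y"
    by (simp add: z complex_eq_iff a_def b_def algebra_simps)
  have "?L y \<in> ?L ` closure (ball 0 1)"
    using y by (intro imageI) simp
  also have "\<dots> \<subseteq> closure (?L ` ball 0 1)"
    by (intro closure_linear_image_subset linear_Complex_scale)
  finally have "?L y \<in> closure (bernstein_ellipse \<rho>)"
    using bernstein_ellipse_eq_image_ball[OF assms(1)] by (simp only: a_def b_def)
  moreover have "?L y \<notin> bernstein_ellipse \<rho>"
    using ab y cmod_power2[of y] by (simp add: bernstein_ellipse_def flip: a_def b_def)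
  ultimately show ?thesis
    by (simp add: eq frontier_def interior_open open_bernstein_ellipse)
qed

section \<open>Cauchy's formula in the Joukowski coordinate\<close>

lemma circlepath_0_kernel_has_integral:
  assumes "norm u < \<rho>"
  shows "((\<lambda>s. circlepath 0 \<rho> s / (circlepath 0 \<rho> s - u)) has_integral 1) {0..1}"
proof -
  have "((\<lambda>w. 1 / (w - u)) has_contour_integral (2 * of_real pi * \<i> * 1)) (circlepath 0 \<rho>)"
    using assms by (intro Cauchy_integral_circlepath) auto
  then have "((\<lambda>s. (circlepath 0 \<rho> s / (circlepath 0 \<rho> s - u)) * (2 * of_real pi * \<i>)) has_integral
      1 * (2 * of_real pi * \<i>)) {0..1}"
    unfolding has_contour_integral_def
    by (rule has_integral_eq[rotated, THEN has_integral_eq_rhs])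
       (simp_all add: vector_derivative_circlepath01, simp add: circlepath)
  then show ?thesis
    by (auto dest: has_integral_divide[where c = "2 * of_real pi * \<i>"])
qed

text \<open>Cauchy's formula along the boundary curve \<open>\<gamma>\<close>, pulled back to the
  circle. Both preimages \<open>u\<close> and \<open>1 / u\<close> of the point lie inside the
  circle, and each contributes one pole to the kernel.\<close>

lemma bernstein_cauchy_kernel:
  fixes f :: "complex \<Rightarrow> complex"
  assumes rho: "\<rho> > 1" and f: "continuous_on (closure (bernstein_ellipse \<rho>)) f"
    "f holomorphic_on bernstein_ellipse \<rho>"
    and u: "u \<noteq> 0" "norm u < \<rho>" "norm (1 / u) < \<rho>" and z: "(u + 1 / u) / 2 \<in> bernstein_ellipse \<rho>"
  shows "((\<lambda>s. f ((circlepath 0 \<rho> s + 1 / circlepath 0 \<rho> s) / 2) *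
      (circlepath 0 \<rho> s / (circlepath 0 \<rho> s - u) + circlepath 0 \<rho> s / (circlepath 0 \<rho> s - 1 / u) - 1))
      has_integral f ((u + 1 / u) / 2)) {0..1}"
proof -
  define J where "J = (\<lambda>w::complex. (w + 1 / w) / 2)"
  define \<gamma> where "\<gamma> = J \<circ> circlepath 0 \<rho>"
  define K where "K s = circlepath 0 \<rho> s / (circlepath 0 \<rho> s - u) +
      circlepath 0 \<rho> s / (circlepath 0 \<rho> s - 1 / u) - 1" for s
  let ?E = "bernstein_ellipse \<rho>"
  let ?c = "2 * of_real pi * \<i>"
  have norm_circ: "norm (circlepath 0 \<rho> s) = \<rho>" for s
    using rho by (simp add: circlepath norm_mult)
  have circ_nz: "circlepath 0 \<rho> s \<noteq> 0" for s
    using norm_circ[of s] rho by auto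
  have front: "\<gamma> s \<in> frontier ?E" for s
    using joukowski_in_frontier[OF rho norm_circ] by (simp add: \<gamma>_def J_def)
  have valid: "valid_path \<gamma>"
    unfolding \<gamma>_def
  proof (rule valid_path_compose_holomorphic)
    show "J holomorphic_on - {0}"
      unfolding J_def by (intro holomorphic_intros) auto
    show "path_image (circlepath 0 \<rho>) \<subseteq> - {0}"
      using circ_nz by (auto simp: path_image_def)
  qed auto
  have deriv: "vector_derivative \<gamma> (at s within {0..1}) =
      ?c * circlepath 0 \<rho> s * ((1 - 1 / (circlepath 0 \<rho> s)\<^sup>2) / 2)" if "s \<in> {0..1}" for s
  proof -
    have "(J has_field_derivative (1 - 1 / (circlepath 0 \<rho> s)\<^sup>2) / 2) (at (circlepath 0 \<rho> s))"
      unfolding J_def using circ_nz[of s]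
      by (auto intro!: derivative_eq_intros simp: power2_eq_square)
    then have "(\<gamma> has_vector_derivative ((2 * pi * \<i> * \<rho> * exp (2 * of_real pi * \<i> * s)) *
        ((1 - 1 / (circlepath 0 \<rho> s)\<^sup>2) / 2))) (at s)"
      unfolding \<gamma>_def by (intro field_vector_diff_chain_at has_vector_derivative_circlepath)
    then have "vector_derivative \<gamma> (at s within {0..1}) =
        (2 * pi * \<i> * \<rho> * exp (2 * of_real pi * \<i> * s)) * ((1 - 1 / (circlepath 0 \<rho> s)\<^sup>2) / 2)"
      using that by (intro vector_derivative_at_within_ivl) auto
    then show ?thesis by (simp add: circlepath)
  qed
  \<comment> \<open>The difference \<open>\<gamma> s - J u\<close> factors as
    \<open>(\<zeta> - u) * (\<zeta> - 1 / u) / (2 * \<zeta>)\<close>; partial fractions then give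
    \<open>K\<close>.\<close>
  have kernel: "?c * circlepath 0 \<rho> s * ((1 - 1 / (circlepath 0 \<rho> s)\<^sup>2) / 2) / (\<gamma> s - J u) = ?c * K s" for s
  proof -
    define \<zeta> where "\<zeta> = circlepath 0 \<rho> s"
    have nz: "\<zeta> \<noteq> 0" "\<zeta> - u \<noteq> 0" "\<zeta> - 1 / u \<noteq> 0"
      using circ_nz[of s] norm_circ[of s] u by (auto simp: \<zeta>_def)
    have "\<gamma> s - J u = (\<zeta> - u) * (\<zeta> - 1 / u) / (2 * \<zeta>)"
      using nz u(1) by (simp add: \<gamma>_def J_def \<zeta>_def[symmetric] field_simps)
    moreover have "\<zeta> * ((1 - 1 / \<zeta>\<^sup>2) / 2) = (\<zeta>\<^sup>2 - 1) / (2 * \<zeta>)"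
      using nz by (simp add: field_simps power2_eq_square)
    moreover have "x / (2 * \<zeta>) / (y / (2 * \<zeta>)) = x / y" for x y
      using nz by simp
    ultimately have "\<zeta> * ((1 - 1 / \<zeta>\<^sup>2) / 2) / (\<gamma> s - J u) = (\<zeta>\<^sup>2 - 1) / ((\<zeta> - u) * (\<zeta> - 1 / u))"
      by (simp only:)
    also have "(\<zeta>\<^sup>2 - 1) = \<zeta> * (\<zeta> - 1 / u) + \<zeta> * (\<zeta> - u) - (\<zeta> - u) * (\<zeta> - 1 / u)"
      using u(1) by (simp add: algebra_simps power2_eq_square diff_divide_distrib)
    also have "\<dots> / ((\<zeta> - u) * (\<zeta> - 1 / u)) = K s"
    proof -
      have "(\<zeta> * y + \<zeta> * x - x * y) / (x * y) = \<zeta> / x + \<zeta> / y - 1" if "x \<noteq> 0" "y \<noteq> 0" for x y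
        using that by (simp add: field_simps)
      from this[OF nz(2,3)] show ?thesis by (simp only: K_def \<zeta>_def[symmetric])
    qed
    finally show ?thesis
      unfolding \<zeta>_def by (metis mult.assoc times_divide_eq_right)
  qed
  \<comment> \<open>The winding number stays unevaluated at first. This form of Cauchy's formula
    tolerates a curve on the boundary, where \<open>g\<close> is only continuous.\<close>
  have weak: "((\<lambda>s. g (\<gamma> s) * K s) has_integral (winding_number \<gamma> (J u) * g (J u))) {0..1}"
    if g: "continuous_on (closure ?E) g" "g holomorphic_on ?E" for g
  proof -
    have int: "interior (closure ?E) = ?E"
      using convex_interior_closure[OF convex_bernstein_ellipse[OF rho]]
      by (simp add: interior_open open_bernstein_ellipse)
    have "((\<lambda>w. g w / (w - J u)) has_contour_integral (of_real (2 * pi) * \<i> * winding_number \<gamma> (J u) * g (J u))) \<gamma>"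
    proof (rule Cauchy_integral_formula_weak[where k = "{}" and S = "closure ?E"])
      show "g field_differentiable at x" if "x \<in> interior (closure ?E) - {}" for x
        using that g(2) open_bernstein_ellipse unfolding int
        by (auto intro: holomorphic_on_imp_differentiable_at)
      show "path_image \<gamma> \<subseteq> closure ?E - {J u}"
        using front z by (fastforce simp: path_image_def frontier_def interior_open open_bernstein_ellipse J_def)
      show "pathfinish \<gamma> = pathstart \<gamma>"
        by (simp add: \<gamma>_def pathfinish_compose pathstart_compose)
      show "J u \<in> interior (closure ?E) - {}"
        using z by (simp add: int J_def)
    qed (use g valid convex_bernstein_ellipse[OF rho] convex_closure in auto)
    then have "((\<lambda>s. (g (\<gamma> s) * K s) * ?c) has_integral (?c * winding_number \<gamma> (J u) * g (J u))) {0..1}"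
      unfolding has_contour_integral_def
    proof (rule has_integral_eq[rotated, THEN has_integral_eq_rhs])
      fix s :: real assume "s \<in> {0..1}"
      then show "g (\<gamma> s) / (\<gamma> s - J u) * vector_derivative \<gamma> (at s within {0..1}) = (g (\<gamma> s) * K s) * ?c"
        using arg_cong[OF kernel[of s], of "\<lambda>y. g (\<gamma> s) * y"] by (simp add: deriv mult_ac)
    qed simp
    from has_integral_divide[OF this, of ?c] show ?thesis by (simp add: mult.commute)
  qed
  \<comment> \<open>For the constant function 1 the formula says that the integral of
    \<open>K\<close> is the winding number, while Cauchy's formula on the circle gives the value 1;
    this replaces a topological argument about \<open>\<gamma>\<close>.\<close>
  have "(K has_integral (1 + 1 - 1)) {0..1}"
    unfolding K_def using has_integral_const_real[of "1::complex" 0 1]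
    by (intro has_integral_add has_integral_diff circlepath_0_kernel_has_integral u) simp
  moreover have "(K has_integral winding_number \<gamma> (J u)) {0..1}"
    using weak[of "\<lambda>_. 1"] by simp
  ultimately have "1 + 1 - 1 = winding_number \<gamma> (J u)"
    by (rule has_integral_unique)
  then show ?thesis
    using weak[OF f] by (simp add: \<gamma>_def J_def K_def o_def)
qed

section \<open>The truncated Chebyshev series and its error\<close>

text \<open>Three-term recurrence: \<open>[:0, 2:]\<close> takes the value \<open>u + 1 / u\<close>,
  and its product with the function of index \<open>k + 1\<close> is the sum of those of indices
  \<open>k\<close> and \<open>k + 2\<close>.\<close>

lemma chebyshev_joukowski:
  "\<exists>p :: complex poly. degree p \<le> k \<and> (\<forall>u. u \<noteq> 0 \<longrightarrow> poly p ((u + 1 / u) / 2) = u ^ k + (1 / u) ^ k)"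
proof (induction k rule: induct_nat_012)
  case 0
  show ?case by (intro exI[of _ "[:2:]"]) simp
next
  case 1
  show ?case by (intro exI[of _ "[:0, 2:]"]) simp
next
  case (ge2 k)
  then obtain p q :: "complex poly" where p: "degree p \<le> k"
      "\<And>u. u \<noteq> 0 \<Longrightarrow> poly p ((u + 1 / u) / 2) = u ^ k + (1 / u) ^ k"
    and q: "degree q \<le> Suc k"
      "\<And>u. u \<noteq> 0 \<Longrightarrow> poly q ((u + 1 / u) / 2) = u ^ Suc k + (1 / u) ^ Suc k"
    by blast
  have "degree ([:0, 2:] * q - p) \<le> Suc (Suc k)"
    using p(1) q(1) degree_mult_le[of "[:0, 2:]" q] by (intro degree_diff_le) auto
  moreover have "poly ([:0, 2:] * q - p) ((u + 1 / u) / 2) = u ^ Suc (Suc k) + (1 / u) ^ Suc (Suc k)"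
    if "u \<noteq> 0" for u
  proof -
    have "poly ([:0, 2:] * q - p) ((u + 1 / u) / 2) =
        (u + 1 / u) * (u ^ Suc k + (1 / u) ^ Suc k) - (u ^ k + (1 / u) ^ k)"
      using p(2)[OF that] q(2)[OF that] by (simp del: mult_pCons_left power_Suc)
    also have "\<dots> = u ^ Suc (Suc k) + (1 / u) ^ Suc (Suc k)"
    proof -
      define w where "w = 1 / u"
      have "u * w = 1" using that by (simp add: w_def)
      then have "(u + w) * (u * U + w * W) - (U + W) = u * (u * U) + w * (w * W)" for U W
        by algebra
      then show ?thesis unfolding w_def[symmetric] power_Suc .
    qed
    finally show ?thesis .
  qed
  ultimately show ?case by blast
qed

lemma geometric_tail:
  fixes a :: "'a :: field"
  assumes "a \<noteq> 1"
  shows "1 / (1 - a) = (\<Sum>k\<le>n. a ^ k) + a ^ (n + 1) / (1 - a)"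
proof -
  have "(\<Sum>k\<le>n. a ^ k) = (1 - a ^ (n + 1)) / (1 - a)"
    using assms sum_gp0[of a n] by simp
  then show ?thesis by (simp add: diff_divide_distrib)
qed

lemma norm_vector_smult: "norm (c *s (v :: complex ^ 'n)) = norm c * norm v"
  by (simp add: norm_vec_def norm_mult L2_set_right_distrib)

lemma norm_geometric_tail_le:
  fixes a :: "'a :: real_normed_field"
  assumes "norm a \<le> r" "r < 1"
  shows "norm (a ^ n / (1 - a)) \<le> r ^ n / (1 - r)"
proof -
  have "1 - r \<le> norm (1 - a)"
    using norm_triangle_ineq2[of 1 a] assms by simp
  moreover have "0 \<le> r"
    using assms(1) norm_ge_zero order.trans by blast
  ultimately show ?thesis
    unfolding norm_divide norm_power using assms
    by (intro frac_le power_mono) auto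
qed

text \<open>Expanding the kernel leaves two geometric tails of ratio at most
  \<open>norm u / \<rho>\<close>, whence the factor 2. Since \<open>q\<close> does not depend on
  \<open>u\<close>, the same polynomial serves on [-1, 1] (with \<open>norm u = 1\<close>) and at
  points outside it.\<close>

lemma bernstein_approx:
  fixes x :: "complex \<Rightarrow> complex ^ 'n"
  assumes rho: "\<rho> > 1" and cont: "continuous_on (closure (bernstein_ellipse \<rho>)) x"
    and hol: "\<And>i. (\<lambda>z. x z $ i) holomorphic_on bernstein_ellipse \<rho>"
    and bound: "\<And>z. z \<in> frontier (bernstein_ellipse \<rho>) \<Longrightarrow> norm (x z) \<le> \<kappa>"
  obtains q where "\<And>u. 1 \<le> norm u \<Longrightarrow> norm u < \<rho> \<Longrightarrow> (u + 1 / u) / 2 \<in> bernstein_ellipse \<rho> \<Longrightarrow>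
    norm (x ((u + 1 / u) / 2) - vpoly R q ((u + 1 / u) / 2)) \<le>
      2 * \<kappa> * (norm u / \<rho>) ^ (R + 1) / (1 - norm u / \<rho>)"
proof -
  let ?E = "bernstein_ellipse \<rho>"
  define \<zeta> where "\<zeta> = circlepath 0 \<rho>"
  define \<gamma> where "\<gamma> s = (\<zeta> s + 1 / \<zeta> s) / 2" for s
  have norm_\<zeta>: "norm (\<zeta> s) = \<rho>" and \<zeta>_nz: "\<zeta> s \<noteq> 0" for s
    using rho by (auto simp: \<zeta>_def circlepath norm_mult)
  have cont_\<zeta>: "continuous_on {0..1} \<zeta>"
    unfolding \<zeta>_def circlepath by (intro continuous_intros)
  have front: "\<gamma> s \<in> frontier ?E" for s
    unfolding \<gamma>_def by (intro joukowski_in_frontier rho norm_\<zeta>)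
  have cont_\<gamma>: "continuous_on {0..1} \<gamma>"
    unfolding \<gamma>_def using \<zeta>_nz by (intro continuous_intros cont_\<zeta>) auto
  have cont_x: "continuous_on {0..1} (\<lambda>s. x (\<gamma> s))"
    using front by (intro continuous_on_compose2[OF cont cont_\<gamma>]) (auto simp: frontier_def)
  then have cont_xi: "continuous_on {0..1} (\<lambda>s. x (\<gamma> s) $ i)" for i
    by (rule continuous_on_component)
  define c where "c k i = integral {0..1} (\<lambda>s. x (\<gamma> s) $ i * (1 / \<zeta> s) ^ k)" for k i
  have c: "((\<lambda>s. x (\<gamma> s) $ i * (1 / \<zeta> s) ^ k) has_integral c k i) {0..1}" for k i
    unfolding c_def using \<zeta>_nz
    by (intro integrable_integral integrable_continuous_real continuous_intros cont_xi cont_\<zeta>) auto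
  obtain T :: "nat \<Rightarrow> complex poly" where T: "\<And>k. degree (T k) \<le> k"
      "\<And>k u. u \<noteq> 0 \<Longrightarrow> poly (T k) ((u + 1 / u) / 2) = u ^ k + (1 / u) ^ k"
    using chebyshev_joukowski by metis
  \<comment> \<open>\<open>T k\<close> is twice the Chebyshev polynomial, also for \<open>k = 0\<close>, so the constant term is counted twice\<close>
  define q where "q j = (\<chi> i. (\<Sum>k\<le>R. c k i * coeff (T k) j) - (if j = 0 then c 0 i else 0))" for j
  have q: "vpoly R q z $ i = (\<Sum>k\<le>R. c k i * poly (T k) z) - c 0 i" for z i
  proof -
    have "poly (T k) z = (\<Sum>j\<le>R. coeff (T k) j * z ^ j)" if "k \<le> R" for k
      unfolding poly_altdef using T(1)[of k] that
      by (intro sum.mono_neutral_left) (auto simp: coeff_eq_0)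
    then have "(\<Sum>k\<le>R. c k i * poly (T k) z) = (\<Sum>j\<le>R. \<Sum>k\<le>R. c k i * (coeff (T k) j * z ^ j))"
      by (subst sum.swap) (simp add: sum_distrib_left)
    moreover have "(\<Sum>j\<le>R. z ^ j * (if j = 0 then c 0 i else 0)) = c 0 i"
      by (subst sum.mono_neutral_right[of _ "{0}"]) auto
    ultimately show ?thesis
      by (simp add: vpoly_def q_def right_diff_distrib sum_subtractf sum_distrib_left mult_ac)
  qed
  show ?thesis
  proof (rule that)
    fix u :: complex
    assume u: "1 \<le> norm u" "norm u < \<rho>" and E: "(u + 1 / u) / 2 \<in> ?E"
    define z where "z = (u + 1 / u) / 2"
    define r where "r = norm u / \<rho>"
    define a b where "a s = u / \<zeta> s" and "b s = 1 / u / \<zeta> s" for s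
    define rem where "rem s = a s ^ (R + 1) / (1 - a s) + b s ^ (R + 1) / (1 - b s)" for s
    have u0: "u \<noteq> 0" using u by auto
    have r: "r < 1" "norm (a s) \<le> r" "norm (b s) \<le> r" for s
    proof -
      have "1 / norm u \<le> norm u"
        using u mult_mono[of 1 "norm u" 1 "norm u"] by (simp add: divide_le_eq)
      then show "r < 1" "norm (a s) \<le> r" "norm (b s) \<le> r"
        using u rho by (auto simp: r_def a_def b_def norm_divide norm_mult norm_\<zeta> divide_right_mono
          simp flip: divide_divide_eq_left)
    qed
    then have ab1: "a s \<noteq> 1" "b s \<noteq> 1" for s
      by (metis norm_one not_le)+
    \<comment> \<open>The powers of \<open>a s\<close> and \<open>b s\<close> pair up to the values
      of \<open>T k\<close> divided by \<open>\<zeta> s ^ k\<close>.\<close>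
    have kernel: "\<zeta> s / (\<zeta> s - u) + \<zeta> s / (\<zeta> s - 1 / u) - 1 =
        (\<Sum>k\<le>R. poly (T k) z * (1 / \<zeta> s) ^ k) - 1 + rem s" for s
    proof -
      have "\<zeta> s / (\<zeta> s - v) = 1 / (1 - v / \<zeta> s)" for v
        using \<zeta>_nz[of s] by (simp add: divide_simps)
      then have "\<zeta> s / (\<zeta> s - u) + \<zeta> s / (\<zeta> s - 1 / u) = 1 / (1 - a s) + 1 / (1 - b s)"
        by (simp add: a_def b_def)
      also have "\<dots> = (\<Sum>k\<le>R. a s ^ k + b s ^ k) + rem s"
        using geometric_tail[OF ab1(1)[of s], of R] geometric_tail[OF ab1(2)[of s], of R] by (simp add: rem_def sum.distrib)
      also have "(\<Sum>k\<le>R. a s ^ k + b s ^ k) = (\<Sum>k\<le>R. poly (T k) z * (1 / \<zeta> s) ^ k)"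
        unfolding z_def T(2)[OF u0] a_def b_def
        by (intro sum.cong refl) (simp add: power_divide power_mult_distrib add_divide_distrib)
      finally show ?thesis by simp
    qed
    have cont_rem: "continuous_on {0..1} rem"
      unfolding rem_def a_def b_def using \<zeta>_nz ab1
      by (intro continuous_intros cont_\<zeta>) (auto simp: a_def b_def)
    have err: "((\<lambda>s. x (\<gamma> s) $ i * rem s) has_integral (x z - vpoly R q z) $ i) {0..1}" for i
    proof -
      have "((\<lambda>s. x (\<gamma> s) $ i * (\<zeta> s / (\<zeta> s - u) + \<zeta> s / (\<zeta> s - 1 / u) - 1)) has_integral x z $ i) {0..1}"
        unfolding z_def \<gamma>_def \<zeta>_def
      proof (rule bernstein_cauchy_kernel[OF rho continuous_on_component[OF cont] hol u0 u(2) _ E])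
        show "norm (1 / u) < \<rho>"
          using u rho by (simp add: norm_divide divide_less_eq) (smt (verit) mult_le_cancel_left1)
      qed
      \<comment> \<open>The factor with exponent 0 is kept so that the last summand is the integrand
        of \<open>c 0 i\<close>.\<close>
      moreover have "((\<lambda>s. (\<Sum>k\<le>R. x (\<gamma> s) $ i * (1 / \<zeta> s) ^ k * poly (T k) z) - x (\<gamma> s) $ i * (1 / \<zeta> s) ^ 0)
          has_integral vpoly R q z $ i) {0..1}"
        unfolding q by (intro has_integral_diff has_integral_sum has_integral_mult_left c) auto
      ultimately have "((\<lambda>s. x (\<gamma> s) $ i * (\<zeta> s / (\<zeta> s - u) + \<zeta> s / (\<zeta> s - 1 / u) - 1) -
          ((\<Sum>k\<le>R. x (\<gamma> s) $ i * (1 / \<zeta> s) ^ k * poly (T k) z) - x (\<gamma> s) $ i * (1 / \<zeta> s) ^ 0))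
          has_integral (x z $ i - vpoly R q z $ i)) {0..1}"
        by (rule has_integral_diff)
      then show ?thesis
        unfolding kernel by (simp add: algebra_simps sum_distrib_left)
    qed
    \<comment> \<open>Components suffice to identify the integral, but its norm is estimated for the
      whole vector, so no factor depending on the dimension appears.\<close>
    define F where "F s = rem s *s x (\<gamma> s)" for s
    have "continuous_on {0..1} F"
      unfolding F_def vector_scalar_mult_def
      by (intro continuous_on_vec_lambda continuous_on_mult cont_rem cont_xi)
    then have F: "(F has_integral integral {0..1} F) {0..1}"
      by (intro integrable_integral integrable_continuous_real)
    have "integral {0..1} F = x z - vpoly R q z"
    proof (rule vec_eq_iff[THEN iffD2], rule allI)
      fix i
      have "((\<lambda>v. v $ i) \<circ> F has_integral integral {0..1} F $ i) {0..1}"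
        by (intro has_integral_linear F bounded_linear_vec_nth)
      then show "integral {0..1} F $ i = (x z - vpoly R q z) $ i"
        using has_integral_unique[OF _ err[of i]] by (simp add: F_def o_def mult.commute)
    qed
    with F have F': "(F has_integral (x z - vpoly R q z)) {0..1}" by simp
    have \<kappa>: "0 \<le> \<kappa>"
      using order.trans[OF norm_ge_zero bound[OF front[of 0]]] .
    have r0: "0 \<le> r" using rho by (simp add: r_def)
    have "norm (x z - vpoly R q z) \<le> 2 * \<kappa> * r ^ (R + 1) / (1 - r) * measure lborel {0..1::real}"
    proof (rule has_integral_bound_real[OF _ finite.emptyI F'])
      show "0 \<le> 2 * \<kappa> * r ^ (R + 1) / (1 - r)"
        using \<kappa> r(1) r0 by simp
      fix s :: real
      have "norm (rem s) \<le> r ^ (R + 1) / (1 - r) + r ^ (R + 1) / (1 - r)"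
        unfolding rem_def by (intro norm_triangle_mono norm_geometric_tail_le r)
      then have "norm (F s) \<le> (r ^ (R + 1) / (1 - r) + r ^ (R + 1) / (1 - r)) * \<kappa>"
        unfolding F_def norm_vector_smult
        using r(1) r0 by (intro mult_mono bound front) auto
      then show "norm (F s) \<le> 2 * \<kappa> * r ^ (R + 1) / (1 - r)"
        by (simp add: mult_ac)
    qed
    then show "norm (x ((u + 1 / u) / 2) - vpoly R q ((u + 1 / u) / 2)) \<le>
      2 * \<kappa> * (norm u / \<rho>) ^ (R + 1) / (1 - norm u / \<rho>)"
      by (simp add: z_def r_def)
  qed
qed

section \<open>The least-squares error\<close>

text \<open>Minimality along the line in direction \<open>e\<close> forces \<open>y\<close> to be
  orthogonal to \<open>e\<close>; then Pythagoras makes the right-hand side equal to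
  \<open>Y + E\<close>.\<close>

lemma least_squares_residual_le:
  fixes y e :: "'a \<Rightarrow> 'b :: real_inner"
  assumes min: "\<And>s. (\<Sum>k\<in>A. (norm (y k))\<^sup>2) \<le> (\<Sum>k\<in>A. (norm (y k - s *\<^sub>R e k))\<^sup>2)"
  shows "(\<Sum>k\<in>A. (norm (e k))\<^sup>2) \<le> (\<Sum>k\<in>A. (norm (y k - e k))\<^sup>2)"
proof -
  define Y B E where "Y = (\<Sum>k\<in>A. (norm (y k))\<^sup>2)" and "B = (\<Sum>k\<in>A. y k \<bullet> e k)"
    and "E = (\<Sum>k\<in>A. (norm (e k))\<^sup>2)"
  have "(norm (a - s *\<^sub>R c))\<^sup>2 = (norm a)\<^sup>2 - 2 * s * (a \<bullet> c) + s\<^sup>2 * (norm c)\<^sup>2" for a c :: 'b and s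
    unfolding power2_norm_eq_inner
    by (simp add: inner_diff_left inner_diff_right inner_commute power2_eq_square algebra_simps)
  then have expand: "(\<Sum>k\<in>A. (norm (y k - s *\<^sub>R e k))\<^sup>2) = Y - 2 * s * B + s\<^sup>2 * E" for s
    by (simp add: Y_def B_def E_def sum.distrib sum_subtractf sum_distrib_left)
  have "B = 0"
  \<comment> \<open>If \<open>E = 0\<close>, the choice \<open>s = B\<close> gives
    \<open>Y \<le> Y - 2 * B^2\<close>. Otherwise \<open>s = B / E\<close> is the minimum point of
    the quadratic in \<open>s\<close>.\<close>
  proof (cases "E = 0")
    case True
    then show ?thesis
      using min[of B] unfolding expand by (auto simp: Y_def[symmetric] mult_le_0_iff)
  next
    case False
    then have E: "E > 0" unfolding E_def by (metis less_eq_real_def sum_nonneg zero_le_power2)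
    have "0 \<le> (B / E)\<^sup>2 * E - 2 * (B / E) * B"
      using min[of "B / E"] unfolding expand Y_def[symmetric] by simp
    also have "\<dots> = - (B\<^sup>2 / E)"
      using E by (simp add: power2_eq_square)
    finally show ?thesis using E by (simp add: divide_le_0_iff)
  qed
  moreover have "Y \<ge> 0" unfolding Y_def by (intro sum_nonneg) auto
  ultimately show ?thesis
    using expand[of 1] by (simp add: E_def)
qed

lemma poly_square_le_equi_sample:
  fixes p :: "real poly"
  assumes "degree p \<le> n" "N > 0" "4 * (real n)\<^sup>2 \<le> real N" "1 < w"
  shows "(poly p ((w + 1 / w) / 2))\<^sup>2 \<le>
    16 / real N * ((2 * real n + 1) / 2 * (w\<^sup>2 ^ (n + 1) / (w\<^sup>2 - 1))) *
      (\<Sum>k\<le>N. (poly p (-1 + real k * (2 / real N)))\<^sup>2)"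
proof -
  have "w\<^sup>2 > 1" using assms by (simp add: one_less_power)
  then have pos: "0 \<le> (2 * real n + 1) / 2 * (w\<^sup>2 ^ (n + 1) / (w\<^sup>2 - 1))" by simp
  have "(poly p ((w + 1 / w) / 2))\<^sup>2 \<le>
      poly_int (p * p) * ((2 * real n + 1) / 2 * (w\<^sup>2 ^ (n + 1) / (w\<^sup>2 - 1)))"
    by (rule poly_square_le_poly_int) (use assms in auto)
  also have "\<dots> \<le> 16 / real N * (\<Sum>k\<le>N. (poly p (-1 + real k * (2 / real N)))\<^sup>2) *
      ((2 * real n + 1) / 2 * (w\<^sup>2 ^ (n + 1) / (w\<^sup>2 - 1)))"
    by (intro mult_right_mono pos poly_int_square_le_sample[OF assms(1-3)])
  also have "\<dots> = 16 / real N * ((2 * real n + 1) / 2 * (w\<^sup>2 ^ (n + 1) / (w\<^sup>2 - 1))) *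
      (\<Sum>k\<le>N. (poly p (-1 + real k * (2 / real N)))\<^sup>2)"
    by (simp only: mult_ac)
  finally show ?thesis .
qed

text \<open>At real points the squared norm is a sum of squares of real polynomials, the real and
  imaginary parts of the components. The scalar estimate for squares is summed over them with the
  constant unchanged.\<close>

lemma norm_vpoly_square_le_sample:
  fixes d :: "nat \<Rightarrow> complex ^ 'n"
  assumes "N > 0" "4 * (real R)\<^sup>2 \<le> real N" "1 < w"
  shows "(norm (vpoly R d (complex_of_real ((w + 1 / w) / 2))))\<^sup>2 \<le>
    16 / real N * ((2 * real R + 1) / 2 * (w\<^sup>2 ^ (R + 1) / (w\<^sup>2 - 1))) *
      (\<Sum>k=1..Suc N. (norm (vpoly R d (complex_of_real (equi_node (Suc N) k))))\<^sup>2)"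
proof -
  let ?K = "16 / real N * ((2 * real R + 1) / 2 * (w\<^sup>2 ^ (R + 1) / (w\<^sup>2 - 1)))"
  define p where "p i = (\<Sum>j\<le>R. monom (Re (d j $ i)) j)" for i
  define q where "q i = (\<Sum>j\<le>R. monom (Im (d j $ i)) j)" for i
  have deg: "degree (p i) \<le> R" "degree (q i) \<le> R" for i
    unfolding p_def q_def
    by (intro degree_sum_le order.trans[OF degree_monom_le]; simp)+
  have norm: "(norm (vpoly R d (complex_of_real s)))\<^sup>2 = (\<Sum>i\<in>UNIV. (poly (p i) s)\<^sup>2 + (poly (q i) s)\<^sup>2)" for s
    unfolding norm_vec_def L2_set_def
    by (simp add: sum_nonneg cmod_power2 vpoly_def p_def q_def poly_sum poly_monom mult.commute
        flip: of_real_power)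
  \<comment> \<open>Nodes are numbered from 1; with \<open>M = N + 1\<close> the spacing
    \<open>2 / (M - 1)\<close> is \<open>2 / N\<close>.\<close>
  have nodes: "(\<Sum>k=1..Suc N. f (equi_node (Suc N) k)) = (\<Sum>k\<le>N. f (-1 + real k * (2 / real N)))"
    for f :: "real \<Rightarrow> real"
    unfolding One_nat_def sum.shift_bounds_cl_Suc_ivl by (simp add: equi_node_def atMost_atLeast0)
  have "(norm (vpoly R d (complex_of_real ((w + 1 / w) / 2))))\<^sup>2 \<le>
      (\<Sum>i\<in>UNIV. ?K * (\<Sum>k\<le>N. (poly (p i) (-1 + real k * (2 / real N)))\<^sup>2) +
        ?K * (\<Sum>k\<le>N. (poly (q i) (-1 + real k * (2 / real N)))\<^sup>2))"
    unfolding norm by (intro sum_mono add_mono poly_square_le_equi_sample deg assms)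
  also have "\<dots> = ?K * (\<Sum>i\<in>UNIV. \<Sum>k\<le>N. (poly (p i) (-1 + real k * (2 / real N)))\<^sup>2 +
      (poly (q i) (-1 + real k * (2 / real N)))\<^sup>2)"
    by (simp only: sum_distrib_left sum.distrib distrib_left)
  also have "(\<Sum>i\<in>UNIV. \<Sum>k\<le>N. (poly (p i) (-1 + real k * (2 / real N)))\<^sup>2 +
      (poly (q i) (-1 + real k * (2 / real N)))\<^sup>2) =
      (\<Sum>k=1..Suc N. (norm (vpoly R d (complex_of_real (equi_node (Suc N) k))))\<^sup>2)"
    unfolding norm nodes[of "\<lambda>s. \<Sum>i\<in>UNIV. (poly (p i) s)\<^sup>2 + (poly (q i) s)\<^sup>2"]
    by (rule sum.swap)
  finally show ?thesis .
qed

section \<open>Cramer's rule, real Joukowski preimages and vector polynomials\<close>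

lemma det_holomorphic_on:
  fixes A :: "complex \<Rightarrow> complex ^ 'n ^ 'n"
  assumes "\<And>i j. (\<lambda>z. A z $ i $ j) holomorphic_on S"
  shows "(\<lambda>z. det (A z)) holomorphic_on S"
  unfolding det_def by (intro holomorphic_intros assms)

lemma det_continuous_on:
  fixes A :: "complex \<Rightarrow> complex ^ 'n ^ 'n"
  assumes "\<And>i j. continuous_on S (\<lambda>z. A z $ i $ j)"
  shows "continuous_on S (\<lambda>z. det (A z))"
  unfolding det_def by (intro continuous_intros assms)

text \<open>As a quotient of determinants, the solution inherits holomorphy and continuity from the
  entries of \<open>A\<close> and \<open>b\<close>.\<close>

lemma matrix_inv_mult_vec_eq_cramer:
  fixes A :: "'a :: field ^ 'n ^ 'n"
  assumes "invertible A"
  shows "matrix_inv A *v b = (\<chi> k. det (\<chi> i j. if j = k then b $ i else A $ i $ j) / det A)"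
proof -
  have "A ** matrix_inv A = mat 1"
    using assms unfolding invertible_def matrix_inv_def by (metis (mono_tags, lifting) someI_ex)
  then have "A *v (matrix_inv A *v b) = b"
    by (simp add: matrix_vector_mul_assoc)
  then show ?thesis
    using cramer[of A] assms by (simp add: invertible_det_nz)
qed

lemma of_real_eq_joukowski_unit:
  assumes "\<bar>x\<bar> \<le> 1"
  obtains u where "norm u = 1" "(u + 1 / u) / 2 = complex_of_real x"
proof -
  define u where "u = Complex x (sqrt (1 - x\<^sup>2))"
  have "x\<^sup>2 \<le> 1" using assms by (simp add: abs_square_le_1)
  then have u: "norm u = 1" by (simp add: u_def cmod_def)
  have "u * cnj u = 1"
    using complex_norm_square[of u] u by simp
  then have "1 / u = cnj u"
    using u by (metis div_by_0 mult.commute nonzero_eq_divide_eq norm_zero zero_neq_one)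
  then have "(u + 1 / u) / 2 = complex_of_real x"
    by (simp add: u_def complex_eq_iff)
  with u show ?thesis using that by blast
qed

lemma inverse_joukowski_real:
  fixes t \<rho> :: real
  assumes "\<rho> > 1" "1 < t" "t < (\<rho> + 1 / \<rho>) / 2"
  defines "w \<equiv> t + sqrt (t\<^sup>2 - 1)"
  shows "(w + 1 / w) / 2 = t" "1 < w" "w < \<rho>"
proof -
  have t2: "t\<^sup>2 > 1" using assms by (simp add: one_less_power)
  then have "0 < sqrt (t\<^sup>2 - 1)" by simp
  then show w1: "1 < w" using assms(2) unfolding w_def by linarith
  have "w * (t - sqrt (t\<^sup>2 - 1)) = 1"
    using t2 by (simp add: w_def algebra_simps flip: power2_eq_square)
  then have "1 / w = t - sqrt (t\<^sup>2 - 1)"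
    using w1 by (simp add: field_simps)
  then show eq: "(w + 1 / w) / 2 = t" by (simp add: w_def)
  show "w < \<rho>"
  proof (rule ccontr)
    assume "\<not> w < \<rho>"
    then have w: "w \<ge> \<rho>" by simp
    have "1 * 1 \<le> w * \<rho>" using w1 assms(1) by (intro mult_mono) auto
    \<comment> \<open>Monotonicity of the Joukowski map: this product is the difference of
      \<open>w + 1 / w\<close> and \<open>\<rho> + 1 / \<rho>\<close>.\<close>
    then have "0 \<le> (w - \<rho>) * (1 - 1 / (w * \<rho>))"
      using w w1 assms(1) by (intro mult_nonneg_nonneg) auto
    also have "\<dots> = (w + 1 / w) - (\<rho> + 1 / \<rho>)"
      using w1 assms(1) by (simp add: field_simps)
    finally show False using eq assms(3) by simp
  qed
qed

lemma abs_equi_node_le_1: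
  assumes "k \<in> {1..M}" "M \<ge> 2"
  shows "\<bar>equi_node M k\<bar> \<le> 1"
proof -
  have "0 \<le> (real k - 1) / (real M - 1)" "(real k - 1) / (real M - 1) \<le> 1"
    using assms by (auto simp: divide_le_eq_1)
  moreover have "equi_node M k = -1 + 2 * ((real k - 1) / (real M - 1))"
    by (simp add: equi_node_def)
  ultimately show ?thesis by (simp only: abs_le_iff) linarith
qed

lemma vpoly_diff: "vpoly R (\<lambda>j. a j - b j) z = vpoly R a z - vpoly R b z"
  by (simp add: vpoly_def vector_sub_rdistrib vec_eq_iff sum_subtractf algebra_simps)

lemma vpoly_add_scaleR: "vpoly R (\<lambda>j. a j + s *\<^sub>R b j) z = vpoly R a z + s *\<^sub>R vpoly R b z"
  by (simp add: vpoly_def vec_eq_iff sum.distrib scaleR_sum_right algebra_simps)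

theorem theorem3:
  fixes \<rho> :: real
    and A :: "complex \<Rightarrow> complex ^ 'n ^ 'n"
    and b :: "complex \<Rightarrow> complex ^ 'n"
    and M R :: nat
    and v :: "nat \<Rightarrow> complex ^ 'n"
    and t :: real
  assumes rho: "\<rho> > 1"
    and A_cont: "continuous_on (closure (bernstein_ellipse \<rho>)) A"
    and b_cont: "continuous_on (closure (bernstein_ellipse \<rho>)) b"
    and A_hol: "\<And>i j. (\<lambda>z. A z $ i $ j) holomorphic_on bernstein_ellipse \<rho>"
    and b_hol: "\<And>i. (\<lambda>z. b z $ i) holomorphic_on bernstein_ellipse \<rho>"
    and A_inv: "\<And>z. z \<in> closure (bernstein_ellipse \<rho>) \<Longrightarrow> invertible (A z)"
    and M: "M \<ge> 2"
    and R: "real R \<le> sqrt (real M - 1) / 2"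
    and pR_min: "\<And>w. frob_residual M (\<lambda>z. matrix_inv (A z) *v b z) (vpoly R v)
                     \<le> frob_residual M (\<lambda>z. matrix_inv (A z) *v b z) (vpoly R w)"
    and t: "1 < t" "t < (\<rho> + 1/\<rho>) / 2"
  shows "let x = (\<lambda>z. matrix_inv (A z) *v b z);
             \<kappa> = (SUP z\<in>frontier (bernstein_ellipse \<rho>). norm (x z));
             r = (t + sqrt (t\<^sup>2 - 1)) / \<rho>;
             C = 5 * sqrt 5 * sqrt (2 * real R + 1) * sqrt (real M) / sqrt (2 * (real M - 1))
         in norm (x (complex_of_real t) - vpoly R v (complex_of_real t))
            \<le> 2 * \<kappa> * (1 / (1 - r) + C * \<rho> / ((\<rho> - 1) * sqrt (\<rho>\<^sup>2 * r\<^sup>2 - 1))) * r ^ (R + 1)"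
proof -
  let ?E = "bernstein_ellipse \<rho>"
  define x where "x = (\<lambda>z. matrix_inv (A z) *v b z)"
  define \<kappa> where "\<kappa> = (SUP z\<in>frontier ?E. norm (x z))"
  define w where "w = t + sqrt (t\<^sup>2 - 1)"
  define r where "r = w / \<rho>"
  define N where "N = M - 1"
  have N: "N > 0" "M = Suc N" using M by (auto simp: N_def)
  have w: "(w + 1 / w) / 2 = t" "1 < w" "w < \<rho>"
    unfolding w_def by (rule inverse_joukowski_real[OF rho t])+
  have r: "0 < r" "r < 1" using w rho by (auto simp: r_def)

  have x_cramer: "x z $ k = det (\<chi> i j. if j = k then b z $ i else A z $ i $ j) / det (A z)"
    if "z \<in> closure ?E" for z k
    by (simp add: x_def matrix_inv_mult_vec_eq_cramer[OF A_inv[OF that]])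
  have det_nz: "det (A z) \<noteq> 0" if "z \<in> closure ?E" for z
    using A_inv[OF that] by (simp add: invertible_det_nz)
  have E_closure: "z \<in> closure ?E" if "z \<in> ?E" for z
    using that closure_subset by blast
  have x_hol: "(\<lambda>z. x z $ k) holomorphic_on ?E" for k
  proof -
    have "(\<lambda>z. (\<chi> i j. if j = k then b z $ i else A z $ i $ j) $ i $ j) holomorphic_on ?E" for i j
      by (cases "j = k") (simp_all add: A_hol b_hol)
    then have "(\<lambda>z. det (\<chi> i j. if j = k then b z $ i else A z $ i $ j) / det (A z)) holomorphic_on ?E"
      using det_nz E_closure by (intro holomorphic_on_divide det_holomorphic_on A_hol) auto
    then show ?thesis
      by (rule holomorphic_transform) (simp add: x_cramer E_closure)
  qed
  have x_cont: "continuous_on (closure ?E) x"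
  proof -
    have A': "continuous_on (closure ?E) (\<lambda>z. A z $ i $ j)" for i j
      using A_cont by (intro continuous_on_component)
    have "continuous_on (closure ?E) (\<lambda>z. (\<chi> i j. if j = k then b z $ i else A z $ i $ j) $ i $ j)" for i j k
      using b_cont by (cases "j = k") (simp_all add: A' continuous_on_component)
    then have "continuous_on (closure ?E)
        (\<lambda>z. \<chi> k. det (\<chi> i j. if j = k then b z $ i else A z $ i $ j) / det (A z))"
      using det_nz
      by (intro continuous_on_vec_lambda continuous_on_divide det_continuous_on A') auto
    then show ?thesis
      by (rule continuous_on_eq) (simp add: vec_eq_iff x_cramer)
  qed
  have \<kappa>: "norm (x z) \<le> \<kappa>" if "z \<in> frontier ?E" for z
  proof -
    have "compact (frontier ?E)"
      by (intro compact_frontier_bounded bounded_bernstein_ellipse rho)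
    moreover have "continuous_on (frontier ?E) (\<lambda>z. norm (x z))"
      by (intro continuous_on_norm continuous_on_subset[OF x_cont]) (auto simp: frontier_def)
    ultimately have "bdd_above ((\<lambda>z. norm (x z)) ` frontier ?E)"
      by (intro bounded_imp_bdd_above compact_imp_bounded compact_continuous_image)
    then show ?thesis
      unfolding \<kappa>_def by (intro cSUP_upper that)
  qed
  \<comment> \<open>The Joukowski image of \<open>\<rho>\<close> witnesses that the frontier is
    nonempty.\<close>
  have \<kappa>0: "0 \<le> \<kappa>"
    using order.trans[OF norm_ge_zero \<kappa>[OF joukowski_in_frontier[OF rho, of "of_real \<rho>"]]] rho by simp
  obtain q where q: "\<And>u. 1 \<le> norm u \<Longrightarrow> norm u < \<rho> \<Longrightarrow> (u + 1 / u) / 2 \<in> ?E \<Longrightarrow>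
      norm (x ((u + 1 / u) / 2) - vpoly R q ((u + 1 / u) / 2)) \<le>
        2 * \<kappa> * (norm u / \<rho>) ^ (R + 1) / (1 - norm u / \<rho>)"
    using bernstein_approx[OF rho x_cont x_hol \<kappa>] by blast

  have far: "norm (x (of_real t) - vpoly R q (of_real t)) \<le> 2 * \<kappa> * r ^ (R + 1) / (1 - r)"
  proof -
    have "(of_real w + 1 / of_real w) / 2 = complex_of_real t"
      unfolding w(1)[symmetric] by simp
    moreover have "complex_of_real t \<in> ?E"
      using t by (intro of_real_in_bernstein_ellipse rho) auto
    ultimately show ?thesis
      using q[of "of_real w"] w by (simp add: r_def)
  qed
  \<comment> \<open>The error of \<open>q\<close> for \<open>norm u = 1\<close>, hence a uniform
    bound at all nodes.\<close>
  define \<delta> where "\<delta> = 2 * \<kappa> * (1 / \<rho>) ^ (R + 1) / (1 - 1 / \<rho>)"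
  have near: "norm (x (of_real s) - vpoly R q (of_real s)) \<le> \<delta>" if s: "\<bar>s\<bar> \<le> 1" for s
  proof -
    obtain u where "norm u = 1" "(u + 1 / u) / 2 = complex_of_real s"
      using of_real_eq_joukowski_unit[OF s] by blast
    moreover have "complex_of_real s \<in> ?E"
      using t s by (intro of_real_in_bernstein_ellipse rho) auto
    ultimately show ?thesis
      using q[of u] rho by (simp add: \<delta>_def)
  qed

  define d where "d j = q j - v j" for j
  define \<tau> where "\<tau> k = complex_of_real (equi_node M k)" for k
  have d: "vpoly R d z = vpoly R q z - vpoly R v z" for z
    unfolding d_def by (rule vpoly_diff)
  \<comment> \<open>The residual \<open>y\<close> is that of the minimiser and the direction is
    \<open>d\<close>, so that \<open>y - d\<close> is the error of \<open>q\<close> at the nodes,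
    bounded by \<open>\<delta>\<close>.\<close>
  have "(\<Sum>k=1..M. (norm (vpoly R d (\<tau> k)))\<^sup>2) \<le>
      (\<Sum>k=1..M. (norm (x (\<tau> k) - vpoly R v (\<tau> k) - vpoly R d (\<tau> k)))\<^sup>2)"
  proof (rule least_squares_residual_le)
    fix s :: real
    have "frob_residual M x (vpoly R v) \<le> frob_residual M x (vpoly R (\<lambda>j. v j + s *\<^sub>R d j))"
      using pR_min by (simp only: x_def)
    then show "(\<Sum>k=1..M. (norm (x (\<tau> k) - vpoly R v (\<tau> k)))\<^sup>2) \<le>
        (\<Sum>k=1..M. (norm (x (\<tau> k) - vpoly R v (\<tau> k) - s *\<^sub>R vpoly R d (\<tau> k)))\<^sup>2)"
      by (simp add: frob_residual_def \<tau>_def vpoly_add_scaleR diff_diff_eq)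
  qed
  also have "\<dots> \<le> (\<Sum>k=1..M. \<delta>\<^sup>2)"
    unfolding d \<tau>_def
    by (intro sum_mono power_mono) (use near abs_equi_node_le_1[OF _ M] in auto)
  finally have sample: "(\<Sum>k=1..M. (norm (vpoly R d (\<tau> k)))\<^sup>2) \<le> real M * \<delta>\<^sup>2"
    by simp

  have R2: "4 * (real R)\<^sup>2 \<le> real N"
  proof -
    have "(2 * real R)\<^sup>2 \<le> (sqrt (real N))\<^sup>2"
      using R N by (intro power_mono) auto
    then show ?thesis by (simp add: power_mult_distrib)
  qed
  define C where "C = 5 * sqrt 5 * sqrt (2 * real R + 1) * sqrt (real M) / sqrt (2 * (real M - 1))"
  define D where "D = C * \<rho> / ((\<rho> - 1) * sqrt (\<rho>\<^sup>2 * r\<^sup>2 - 1))"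
  have w2: "w\<^sup>2 > 1" using w by (simp add: one_less_power)
  have wr: "\<rho>\<^sup>2 * r\<^sup>2 = w\<^sup>2" using rho by (simp add: r_def power_divide)
  have C2: "C\<^sup>2 = 125 * (2 * real R + 1) * real M / (2 * real N)"
    using N by (simp add: C_def power_divide power_mult_distrib)
  have "(norm (vpoly R d (of_real t)))\<^sup>2 \<le>
      16 / real N * ((2 * real R + 1) / 2 * (w\<^sup>2 ^ (R + 1) / (w\<^sup>2 - 1))) *
        (\<Sum>k=1..M. (norm (vpoly R d (\<tau> k)))\<^sup>2)"
    using norm_vpoly_square_le_sample[OF N(1) R2 w(2), of d] by (simp only: w(1) N(2) \<tau>_def)
  also have "\<dots> \<le> 16 / real N * ((2 * real R + 1) / 2 * (w\<^sup>2 ^ (R + 1) / (w\<^sup>2 - 1))) * (real M * \<delta>\<^sup>2)"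
    using w2 by (intro mult_left_mono sample) auto
  \<comment> \<open>The constant 16 is enlarged to \<open>125 = (5 * sqrt 5)^2\<close>, the one in
    \<open>C\<close>.\<close>
  also have "\<dots> \<le> 125 / real N * ((2 * real R + 1) / 2 * (w\<^sup>2 ^ (R + 1) / (w\<^sup>2 - 1))) * (real M * \<delta>\<^sup>2)"
    using w2 by (intro mult_right_mono divide_right_mono) auto
  also have "\<dots> = C\<^sup>2 * (w ^ (R + 1) * \<delta>)\<^sup>2 / (w\<^sup>2 - 1)"
  proof -
    have "w\<^sup>2 ^ (R + 1) = (w ^ (R + 1))\<^sup>2"
      by (simp only: power_mult[symmetric] mult.commute)
    moreover have "125 / n * (k / 2 * (y\<^sup>2 / e)) * (m * \<delta>\<^sup>2) = 125 * k * m / (2 * n) * (y * \<delta>)\<^sup>2 / e"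
      for n k y e m :: real
      by (simp add: power_mult_distrib mult_ac)
    ultimately show ?thesis by (simp only: C2)
  qed
  \<comment> \<open>Growth \<open>w^(R+1)\<close> away from the interval and decay
    \<open>\<rho>^-(R+1)\<close> at the nodes combine to \<open>r^(R+1)\<close>.\<close>
  also have "w ^ (R + 1) * \<delta> = 2 * \<kappa> * r ^ (R + 1) * (\<rho> / (\<rho> - 1))"
    using rho by (simp add: \<delta>_def r_def power_divide field_simps)
  also have "C\<^sup>2 * (2 * \<kappa> * r ^ (R + 1) * (\<rho> / (\<rho> - 1)))\<^sup>2 / (w\<^sup>2 - 1) = (2 * \<kappa> * D * r ^ (R + 1))\<^sup>2"
    using w2 by (simp add: D_def wr power_mult_distrib power_divide)
  finally have "norm (vpoly R d (of_real t)) \<le> 2 * \<kappa> * D * r ^ (R + 1)"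
  proof (rule power2_le_imp_le)
    show "0 \<le> 2 * \<kappa> * D * r ^ (R + 1)"
      using \<kappa>0 r rho N w2 by (simp add: D_def C_def wr)
  qed
  then have "norm (x (of_real t) - vpoly R v (of_real t)) \<le>
      2 * \<kappa> * r ^ (R + 1) / (1 - r) + 2 * \<kappa> * D * r ^ (R + 1)"
    using norm_triangle_mono[OF far] d[of "of_real t"] by fastforce
  then have "norm (x (of_real t) - vpoly R v (of_real t)) \<le> 2 * \<kappa> * (1 / (1 - r) + D) * r ^ (R + 1)"
    by (simp add: algebra_simps)
  then show ?thesis
    unfolding Let_def D_def C_def r_def w_def \<kappa>_def x_def .
qed

end
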